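(* Assume (A1)-(A3). Assume that there exists a bounded function $w:(0,1)\times S\to\mathbb R$, continuously differentiable in the first variable, such that $$\alpha\theta\frac{dw}{d\theta}(\theta,i)=\inf_{u\in U_i}\Bigl[\theta c(i,u)w(\theta,i)+\sum_{j\in S}\lambda_{ij}(u)w(\theta,j)\Bigr]\quad\text{on }(0,1)\times S$$ and $w(\theta,i)\to1$ as $\theta\to0$ uniformly in $i$. Then $w(\theta,i)=W_\alpha(\theta,i)$ for all $(\theta,i)\in(0,1)\times S$. Furthermore, for each $\theta\in(0,1)$, an optimal control for the criterion defining $W_\alpha(\theta,\cdot)$ is given by the Markov control $U^*_t=\mathbf u^*(\theta e^{-\alpha t},X_{t-})$, where $\mathbf u^*$ is given by $$\inf_{u\in U_i}\Bigl[\theta c(i,u)w(\theta,i)+\sum_j\lambda_{ij}(u)w(\theta,j)\Bigr]=\theta c(i,\mathbf u^*(\theta,i))w(\theta,i)+\sum_j\lambda_{ij}(\mathbf u^*(\theta,i))w(\theta,j),\qquad(\theta,i)\in(0,1)\times S.$$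
   Context: State space $S=\{0,1,2,\dots\}$ (countable, discrete). For each $i\in S$, $U_i$ is a (nonempty) compact metric space of actions; $U=\bigcup_i U_i$, $K=\{(i,u): i\in S,u\in U_i\}$. For $j\ne i$, $\lambda_{ij}:U_i\to[0,\infty)$ are given transition rates, and $\lambda_{ii}(u)=-\sum_{j\ne i}\lambda_{ij}(u)$. Assumptions: (A1) every $\lambda_{ij}$ is continuous; (A2) $\sup_i\sup_{u\in U_i}\{-\lambda_{ii}(u)\}\le M<\infty$; (A3) for each $i$ the series $\sum_{j\neq i}\lambda_{ij}(u)$ converges uniformly in $u\in U_i$ (so $\lambda_{ii}$ is continuous). A Markov control is a map $\mathbf{u}:[0,\infty)\times S\to U$ with $\mathbf{u}(\cdot,i)$ measurable and $U_i$-valued for each $i$; $\mathcal U$ is the set of Markov controls. Let $\Lambda^{\mathbf u}_tf(i)=\sum_j\lambda_{ij}(\mathbf u(t,i))f(j)$ for bounded $f:S\to\mathbb R$. Let $(X_t)_{t\ge0}$ be the canonical process on the space of right-continuous $S$-valued paths with left limits. $\mathbb P^{\mathbf u}_i$ (expectation $\mathbb E^{\mathbf u}_i$) is the law solving the well-posed martingale problem: $X_0=i$ a.s. and $f(X_t)-\int_0^t\Lambda^{\mathbf u}_rf(X_r)\,dr$ is a martingale for every bounded $f$; i.e. $X$ is a Markov jump process started at $i$ with rates $\lambda_{ij}(\mathbf u(t,i))$. The control process is $U_t=\mathbf u(t,X_{t-})$. Discounted cost data: $c:K\to[0,\infty)$ bounded with $c(i,\cdot)$ continuous for each $i$; discount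 factor $\alpha>0$. For $\theta\in(0,1)$, $$I_\alpha(\theta,i,\mathbf u)=\frac1\theta\log\mathbb E^{\mathbf u}_i\Bigl[\exp\Bigl(\theta\int_0^\infty e^{-\alpha t}c(X_t,U_t)\,dt\Bigr)\Bigr],\qquad W_\alpha(\theta,i)=\inf_{\mathbf u\in\mathcal U}\exp[\theta I_\alpha(\theta,i,\mathbf u)].$$ A control is optimal (for given $\theta$) if it attains this infimum for every $i\in S$. The function $\mathbf u^*:(0,1)\times S\to U$ is understood to be a selector with $\mathbf u^*(\cdot,i)$ measurable and $U_i$-valued for each $i$. *)

theory Defs
  imports "HOL-Probability.Probability"
begin

text \<open>
  The action space of state \<open>i\<close> is the metric space with carrier \<open>U i\<close> and distance \<open>d i\<close>; the
  type \<open>'u\<close> is only a common container for the sets \<open>U i\<close>, which need not share a metric. The time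
  axis \<open>[0,\<infinity>)\<close> is \<open>{0..} :: real set\<close>, and the values at negative times of functions defined on
  all of \<open>real\<close> are never used.
\<close>

definition borel_of :: "'a topology \<Rightarrow> 'a measure" where
  "borel_of X = sigma (topspace X) {S. openin X S}"

definition action_borel :: "(nat \<Rightarrow> 'u set) \<Rightarrow> (nat \<Rightarrow> 'u \<Rightarrow> 'u \<Rightarrow> real) \<Rightarrow> nat \<Rightarrow> 'u measure" where
  "action_borel U d i = borel_of (Metric_space.mtopology (U i) (d i))"

text \<open>Measurability into \<open>action_borel U d i\<close> includes that the values lie in \<open>U i\<close>.\<close>

definition markov_controls ::
  "(nat \<Rightarrow> 'u set) \<Rightarrow> (nat \<Rightarrow> 'u \<Rightarrow> 'u \<Rightarrow> real) \<Rightarrow> (real \<Rightarrow> nat \<Rightarrow> 'u) set" where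
  "markov_controls U d =
     {u. \<forall>i. (\<lambda>t. u t i) \<in> restrict_space borel {0..} \<rightarrow>\<^sub>M action_borel U d i}"

definition generator ::
  "(nat \<Rightarrow> nat \<Rightarrow> 'u \<Rightarrow> real) \<Rightarrow> (real \<Rightarrow> nat \<Rightarrow> 'u) \<Rightarrow> real \<Rightarrow> (nat \<Rightarrow> real) \<Rightarrow> nat \<Rightarrow> real" where
  "generator lam u t f i = (\<Sum>j. lam i j (u t i) * f j)"

text \<open>
  A path is an extensional function on \<open>{0..}\<close>. Limits in \<open>nat\<close> are taken in its order topology,
  which is discrete.
\<close>

definition cadlag :: "(real \<Rightarrow> nat) set" where
  "cadlag = {\<omega>. (\<forall>t\<ge>0. continuous (at_right t) \<omega>) \<and> (\<forall>t>0. \<exists>l. (\<omega> \<longlongrightarrow> l) (at_left t))}"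

definition path_space :: "(real \<Rightarrow> nat) measure" where
  "path_space = restrict_space (\<Pi>\<^sub>M t\<in>{0..}. count_space UNIV) cadlag"

definition path_filtration :: "real \<Rightarrow> (real \<Rightarrow> nat) measure" where
  "path_filtration t =
     sigma (space path_space) {{\<omega> \<in> space path_space. \<omega> s \<in> A} | s A. 0 \<le> s \<and> s \<le> t}"

text \<open>The value at \<open>0\<close> is a convention; it affects no integral over time.\<close>

definition left_value :: "(real \<Rightarrow> nat) \<Rightarrow> real \<Rightarrow> nat" where
  "left_value \<omega> t = (if t \<le> 0 then \<omega> 0 else Lim (at_left t) \<omega>)"

definition is_martingale ::
  "'a measure \<Rightarrow> (real \<Rightarrow> 'a measure) \<Rightarrow> (real \<Rightarrow> 'a \<Rightarrow> real) \<Rightarrow> bool" where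
  "is_martingale Q F Z \<longleftrightarrow>
     (\<forall>t\<ge>0. subalgebra Q (F t) \<and> Z t \<in> borel_measurable (F t) \<and> integrable Q (Z t)) \<and>
     (\<forall>s t. 0 \<le> s \<longrightarrow> s \<le> t \<longrightarrow> (AE \<omega> in Q. real_cond_exp Q (F s) (Z t) \<omega> = Z s \<omega>))"

definition solves_martingale_problem ::
  "(nat \<Rightarrow> nat \<Rightarrow> 'u \<Rightarrow> real) \<Rightarrow> (real \<Rightarrow> nat \<Rightarrow> 'u) \<Rightarrow> nat \<Rightarrow> (real \<Rightarrow> nat) measure \<Rightarrow> bool" where
  "solves_martingale_problem lam u i Q \<longleftrightarrow>
     prob_space Q \<and> sets Q = sets path_space \<and>
     (AE \<omega> in Q. \<omega> 0 = i) \<and>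
     (\<forall>f :: nat \<Rightarrow> real. bounded (range f) \<longrightarrow>
        is_martingale Q path_filtration
          (\<lambda>t \<omega>. f (\<omega> t) - (LINT r:{0..t}|lborel. generator lam u r f (\<omega> r))))"

definition discounted_cost ::
  "(nat \<Rightarrow> 'u \<Rightarrow> real) \<Rightarrow> real \<Rightarrow> (real \<Rightarrow> nat \<Rightarrow> 'u) \<Rightarrow> (real \<Rightarrow> nat) \<Rightarrow> real" where
  "discounted_cost c \<alpha> u \<omega> =
     (LINT t:{0..}|lborel. exp (- \<alpha> * t) * c (\<omega> t) (u t (left_value \<omega> t)))"

text \<open>In what follows \<open>P u i\<close> is the law of the process under the control \<open>u\<close> started at \<open>i\<close>.\<close>

definition risk_cost ::
  "((real \<Rightarrow> nat \<Rightarrow> 'u) \<Rightarrow> nat \<Rightarrow> (real \<Rightarrow> nat) measure) \<Rightarrow> (nat \<Rightarrow> 'u \<Rightarrow> real) \<Rightarrow> real \<Rightarrow>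
   real \<Rightarrow> nat \<Rightarrow> (real \<Rightarrow> nat \<Rightarrow> 'u) \<Rightarrow> real" where
  "risk_cost P c \<alpha> \<theta> i u =
     1 / \<theta> * ln (\<integral>\<omega>. exp (\<theta> * discounted_cost c \<alpha> u \<omega>) \<partial>(P u i))"

definition value_fun ::
  "(nat \<Rightarrow> 'u set) \<Rightarrow> (nat \<Rightarrow> 'u \<Rightarrow> 'u \<Rightarrow> real) \<Rightarrow>
   ((real \<Rightarrow> nat \<Rightarrow> 'u) \<Rightarrow> nat \<Rightarrow> (real \<Rightarrow> nat) measure) \<Rightarrow> (nat \<Rightarrow> 'u \<Rightarrow> real) \<Rightarrow> real \<Rightarrow>
   real \<Rightarrow> nat \<Rightarrow> real" where
  "value_fun U d P c \<alpha> \<theta> i = (INF u\<in>markov_controls U d. exp (\<theta> * risk_cost P c \<alpha> \<theta> i u))"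

definition optimal_control ::
  "(nat \<Rightarrow> 'u set) \<Rightarrow> (nat \<Rightarrow> 'u \<Rightarrow> 'u \<Rightarrow> real) \<Rightarrow>
   ((real \<Rightarrow> nat \<Rightarrow> 'u) \<Rightarrow> nat \<Rightarrow> (real \<Rightarrow> nat) measure) \<Rightarrow> (nat \<Rightarrow> 'u \<Rightarrow> real) \<Rightarrow> real \<Rightarrow>
   real \<Rightarrow> (real \<Rightarrow> nat \<Rightarrow> 'u) \<Rightarrow> bool" where
  "optimal_control U d P c \<alpha> \<theta> u \<longleftrightarrow>
     u \<in> markov_controls U d \<and>
     (\<forall>i. exp (\<theta> * risk_cost P c \<alpha> \<theta> i u) = value_fun U d P c \<alpha> \<theta> i)"

definition hjb_expr ::
  "(nat \<Rightarrow> nat \<Rightarrow> 'u \<Rightarrow> real) \<Rightarrow> (nat \<Rightarrow> 'u \<Rightarrow> real) \<Rightarrow> (real \<Rightarrow> nat \<Rightarrow> real) \<Rightarrow>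
   real \<Rightarrow> nat \<Rightarrow> 'u \<Rightarrow> real" where
  "hjb_expr lam c w \<theta> i v = \<theta> * c i v * w \<theta> i + (\<Sum>j. lam i j v * w \<theta> j)"

definition minimizing_selector ::
  "(nat \<Rightarrow> 'u set) \<Rightarrow> (nat \<Rightarrow> 'u \<Rightarrow> 'u \<Rightarrow> real) \<Rightarrow> (nat \<Rightarrow> nat \<Rightarrow> 'u \<Rightarrow> real) \<Rightarrow>
   (nat \<Rightarrow> 'u \<Rightarrow> real) \<Rightarrow> (real \<Rightarrow> nat \<Rightarrow> real) \<Rightarrow> (real \<Rightarrow> nat \<Rightarrow> 'u) \<Rightarrow> bool" where
  "minimizing_selector U d lam c w us \<longleftrightarrow>
     (\<forall>i. (\<lambda>\<theta>. us \<theta> i) \<in> restrict_space borel {0<..<1} \<rightarrow>\<^sub>M action_borel U d i) \<and>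
     (\<forall>\<theta>\<in>{0<..<1}. \<forall>i.
        (INF v\<in>U i. hjb_expr lam c w \<theta> i v) = hjb_expr lam c w \<theta> i (us \<theta> i))"

end

theory Submission
  imports Defs
begin

text \<open>
  Put \<open>V t i = w (\<theta> * exp (- \<alpha> * t)) i\<close> and let \<open>A t\<close> be the discounted cost (times \<open>\<theta>\<close>) accumulated up
  to time \<open>t\<close>. The equation for \<open>w\<close> bounds \<open>\<theta> * w' \<theta>\<close> uniformly in the state, so \<open>V\<close> is
  Lipschitz in time, uniformly in the state. It suffices to show that \<open>\<phi> t = E (exp (A t) * V t (X t))\<close> is
  nondecreasing for every control and constant for a minimizing one: \<open>\<phi> 0 = w \<theta> i\<close>, and \<open>\<phi> t\<close> tends to
  the expected exponential cost because \<open>V t\<close> tends to \<open>1\<close> uniformly.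

  No time-dependent Dynkin formula is needed for this. On a short interval \<open>[s, s + h]\<close> freeze the time in the
  test function \<open>V s\<close> and apply the martingale property, and freeze the state at \<open>X s\<close> in all
  integrals; since \<open>X\<close> jumps in the interval with probability at most \<open>M * h\<close>, both errors
  are of order \<open>h\<^sup>2\<close>, whereas the frozen main term has the right sign by the equation for \<open>w\<close>. Hence
  \<open>\<phi> (s + h) \<ge> \<phi> s - K * h\<^sup>2\<close>, which makes \<open>\<phi>\<close> nondecreasing; for a minimizing control the same applies to \<open>- V\<close>.
\<close>

section \<open>Measurable selection\<close>

text \<open>A control is only measurable in time, so \<open>\<phi>\<close> need not be
  differentiable; this is why the sign condition is used integrated over \<open>[s, s + h]\<close>
  and the errors are summed over a partition. The martingale problem knows only fixed test functions
  of the state; the weight \<open>exp (A s)\<close> enters as a bounded factor known at time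
  \<open>s\<close>. The error constants must be uniform over infinitely many states, which the
  common bound \<open>M\<close> on the exit rates provides. The bound on
  \<open>\<theta> * w'\<close> still allows \<open>w'\<close> to grow like
  \<open>1 / \<theta>\<close> near \<open>0\<close>, so \<open>w\<close> is estimated on the scale
  of \<open>ln \<theta>\<close>, where \<open>\<theta> * exp (- \<alpha> * t)\<close> is linear in
  \<open>t\<close>. No estimate uses the sign of \<open>V\<close>, and therefore \<open>- V\<close>
  is admissible.

  Monotonicity alone yields only that \<open>w\<close> is at most the cost of every control. For
  equality some admissible control has to be minimizing at all times. Compactness gives a minimizer
  for each parameter and state, but a measurable choice among them must be constructed. It rests on
  continuity of the minimized expression in the action, from (A1) and (A3), and on its continuity in
  the parameter, uniformly in the action.\<close>

lemma space_borel_of [simp]: "space (borel_of X) = topspace X"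
  by (simp add: borel_of_def space_measure_of_conv)

lemma openin_imp_sets_borel_of: "openin X S \<Longrightarrow> S \<in> sets (borel_of X)"
  unfolding borel_of_def by (subst sets_measure_of) (auto dest: openin_subset)

lemma borel_measurable_continuous_map:
  assumes "continuous_map X euclidean f"
  shows "f \<in> borel_measurable (borel_of X)"
proof (rule borel_measurableI)
  fix S :: "'b set" assume "open S"
  then have "openin X {x \<in> topspace X. f x \<in> S}"
    using assms by (auto simp: continuous_map_def)
  then have "{x \<in> topspace X. f x \<in> S} \<in> sets (borel_of X)"
    by (rule openin_imp_sets_borel_of)
  moreover have "f -` S \<inter> space (borel_of X) = {x \<in> topspace X. f x \<in> S}"
    by auto
  ultimately show "f -` S \<inter> space (borel_of X) \<in> sets (borel_of X)"
    by simp
qed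

text \<open>The base consists of closed balls of radius \<open>1 / Suc m\<close> around finite nets
  of that mesh. Closed sets are wanted because the selection below intersects them and relies on
  compactness for a nonempty intersection.\<close>

lemma (in Metric_space) compact_space_countable_closed_base:
  assumes "compact_space mtopology" "M \<noteq> {}"
  obtains C :: "nat \<Rightarrow> 'a set" where
    "\<And>n. closedin mtopology (C n)"
    "\<And>V x. openin mtopology V \<Longrightarrow> x \<in> V \<Longrightarrow> \<exists>n. x \<in> C n \<and> C n \<subseteq> V"
proof -
  have tb: "mtotally_bounded M"
    using assms(1) by (simp add: compact_space_def compactin_imp_mtotally_bounded)
  have "\<exists>K. finite K \<and> K \<subseteq> M \<and> M \<subseteq> (\<Union>x\<in>K. mball x (1 / Suc m))" for m
    using tb unfolding mtotally_bounded_def by simp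
  then obtain K where K: "\<And>m. finite (K m)" "\<And>m. K m \<subseteq> M"
      "\<And>m. M \<subseteq> (\<Union>x\<in>K m. mball x (1 / Suc m))"
    by metis
  define F where "F = (\<Union>m. (\<lambda>x. mcball x (1 / Suc m)) ` K m)"
  have F_c: "countable F"
    unfolding F_def by (intro countable_UN countable_image countable_finite[OF K(1)]) auto
  have "K 0 \<noteq> {}"
    using K(3)[of 0] assms(2) by auto
  then have "F \<noteq> {}"
    by (auto simp: F_def)
  note F = F_c this
  have ran: "range (from_nat_into F) = F"
    by (rule range_from_nat_into[OF F(2,1)])
  show thesis
  proof (rule that)
    show "closedin mtopology (from_nat_into F n)" for n
      using from_nat_into[OF F(2), of n] by (auto simp: F_def)
    fix V x assume V: "openin mtopology V" and x: "x \<in> V"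
    then obtain r where r: "r > 0" "mball x r \<subseteq> V" and xM: "x \<in> M"
      by (meson openin_mtopology subsetD)
    obtain m where m: "1 / Suc m < r / 2"
      using reals_Archimedean[of "r / 2"] r(1) by (auto simp: inverse_eq_divide)
    obtain y where y: "y \<in> K m" "x \<in> mball y (1 / Suc m)"
      using K(3)[of m] xM by auto
    have "mcball y (1 / Suc m) \<subseteq> V"
    proof
      fix z assume z: "z \<in> mcball y (1 / Suc m)"
      have "d x z \<le> d x y + d y z"
        using y z xM by (intro triangle) auto
      then have "d x z < r"
        using y z m by (auto simp: commute)
      then show "z \<in> V" using r z xM by auto
    qed
    moreover have "mcball y (1 / Suc m) \<in> F" using y by (auto simp: F_def)
    moreover have "x \<in> mcball y (1 / Suc m)" using y by auto
    ultimately show "\<exists>n. x \<in> from_nat_into F n \<and> from_nat_into F n \<subseteq> V"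
      using ran by (metis (no_types, lifting) imageE)
  qed
qed

text \<open>
  Intersect \<open>K \<theta>\<close> successively with those members of a countable closed base that still meet
  what is left; the intersection shrinks to the selected point.
\<close>

lemma (in Metric_space) measurable_selection:
  assumes comp: "compact_space mtopology"
    and K: "\<And>\<theta>. \<theta> \<in> space N \<Longrightarrow> closedin mtopology (K \<theta>)" "\<And>\<theta>. \<theta> \<in> space N \<Longrightarrow> K \<theta> \<noteq> {}"
    and meas: "\<And>C. closedin mtopology C \<Longrightarrow> {\<theta> \<in> space N. K \<theta> \<inter> C \<noteq> {}} \<in> sets N"
  shows "\<exists>s \<in> N \<rightarrow>\<^sub>M borel_of mtopology. \<forall>\<theta>\<in>space N. s \<theta> \<in> K \<theta>"
proof (cases "M = {}")
  case True
  then have "K \<theta> = {}" if "\<theta> \<in> space N" for \<theta>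
    using closedin_subset[OF K(1)[OF that], unfolded topspace_mtopology] by blast
  with K(2) have "space N = {}" by blast
  then show ?thesis by (auto simp: measurable_def)
next
  case False
  obtain C :: "nat \<Rightarrow> 'a set" where C: "\<And>n. closedin mtopology (C n)"
    "\<And>V x. openin mtopology V \<Longrightarrow> x \<in> V \<Longrightarrow> \<exists>n. x \<in> C n \<and> C n \<subseteq> V"
    using compact_space_countable_closed_base[OF comp False] by blast
  define S where "S \<theta> = rec_nat (K \<theta>) (\<lambda>n T. if T \<inter> C n \<noteq> {} then T \<inter> C n else T)" for \<theta>
  have S0: "S \<theta> 0 = K \<theta>"
    and S_Suc: "S \<theta> (Suc n) = (if S \<theta> n \<inter> C n \<noteq> {} then S \<theta> n \<inter> C n else S \<theta> n)" for \<theta> n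
    by (simp_all add: S_def)
  have S: "closedin mtopology (S \<theta> n)" "S \<theta> n \<noteq> {}" if "\<theta> \<in> space N" for \<theta> n
    using that by (induction n) (simp_all add: S0 S_Suc K C(1) closedin_Int)
  have dec: "decseq (S \<theta>)" for \<theta>
    by (rule decseq_SucI) (auto simp: S_Suc)
  \<comment> \<open>Nested nonempty closed sets in a compact space have a common point. An arbitrary
    one is chosen; its measurability comes only from \<open>in_C\<close> below.\<close>
  have "\<exists>x. \<forall>n. x \<in> S \<theta> n" if "\<theta> \<in> space N" for \<theta>
  proof -
    have "\<Inter> (range (S \<theta>)) \<noteq> {}"
      using comp[unfolded compact_space_nest, rule_format, of "S \<theta>"] S[OF that] dec[of \<theta>] by simp
    then show ?thesis by auto
  qed
  then obtain s where s: "\<And>\<theta> n. \<theta> \<in> space N \<Longrightarrow> s \<theta> \<in> S \<theta> n"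
    by metis
  \<comment> \<open>In the induction, stage \<open>Suc n\<close> meets \<open>D\<close> if stage
    \<open>n\<close> meets \<open>C n \<inter> D\<close>, or if stage \<open>n\<close> misses
    \<open>C n\<close> altogether and meets \<open>D\<close>. Closedness of
    \<open>C n \<inter> D\<close> is the reason for quantifying over all closed
    \<open>D\<close>.\<close>
  have meets: "{\<theta> \<in> space N. S \<theta> n \<inter> D \<noteq> {}} \<in> sets N" if "closedin mtopology D" for n D
    using that
  proof (induction n arbitrary: D)
    case 0
    then show ?case using meas by (simp add: S0)
  next
    case (Suc n)
    have "{\<theta> \<in> space N. S \<theta> (Suc n) \<inter> D \<noteq> {}} =
      {\<theta> \<in> space N. S \<theta> n \<inter> (C n \<inter> D) \<noteq> {}} \<union>
      ({\<theta> \<in> space N. S \<theta> n \<inter> D \<noteq> {}} - {\<theta> \<in> space N. S \<theta> n \<inter> C n \<noteq> {}})"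
      by (auto simp: S_Suc Int_assoc)
    also have "\<dots> \<in> sets N"
      using Suc C(1) by (intro sets.Un sets.Diff Suc.IH closedin_Int) auto
    finally show ?case .
  qed
  \<comment> \<open>Whether the selected point lies in \<open>C n\<close> is already decided at
    stage \<open>n\<close>: if that stage meets \<open>C n\<close>, the next one lies inside it, and
    otherwise the point, being in stage \<open>n\<close>, is outside.\<close>
  have in_C: "s \<theta> \<in> C n \<longleftrightarrow> S \<theta> n \<inter> C n \<noteq> {}" if "\<theta> \<in> space N" for \<theta> n
    using s[OF that, of n] s[OF that, of "Suc n"] by (auto simp: S_Suc split: if_splits)
  have sK: "s \<theta> \<in> K \<theta>" if "\<theta> \<in> space N" for \<theta>
    using s[OF that, of 0] by (simp add: S0)
  have "s \<in> N \<rightarrow>\<^sub>M borel_of mtopology"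
    unfolding borel_of_def
  proof (rule measurable_measure_of)
    show "s \<in> space N \<rightarrow> topspace mtopology"
      using sK closedin_subset[OF K(1)] by auto
    fix V assume "V \<in> {S. openin mtopology S}"
    then have V: "openin mtopology V" by simp
    have "s -` V \<inter> space N = (\<Union>n\<in>{n. C n \<subseteq> V}. {\<theta> \<in> space N. S \<theta> n \<inter> C n \<noteq> {}})"
    proof -
      have "s \<theta> \<in> V \<longleftrightarrow> (\<exists>n. C n \<subseteq> V \<and> s \<theta> \<in> C n)" for \<theta>
        using C(2)[OF V, of "s \<theta>"] by blast
      then have "s -` V \<inter> space N = (\<Union>n\<in>{n. C n \<subseteq> V}. {\<theta> \<in> space N. s \<theta> \<in> C n})"
        by blast
      also have "\<dots> = (\<Union>n\<in>{n. C n \<subseteq> V}. {\<theta> \<in> space N. S \<theta> n \<inter> C n \<noteq> {}})"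
        by (intro SUP_cong refl Collect_cong) (simp add: in_C cong: conj_cong)
      finally show ?thesis .
    qed
    also have "\<dots> \<in> sets N"
      using meets[OF C(1)] by (intro sets.countable_UN') auto
    finally show "s -` V \<inter> space N \<in> sets N" .
  qed (auto dest!: openin_subset)
  with sK show ?thesis by blast
qed

section \<open>Cadlag paths\<close>

lemma space_path_space: "space path_space = (\<Pi>\<^sub>E t\<in>{0..}. UNIV) \<inter> cadlag"
  by (simp add: path_space_def space_restrict_space space_PiM Int_commute)

lemma measurable_path_space_component:
  assumes "0 \<le> t"
  shows "(\<lambda>\<omega>. \<omega> t) \<in> path_space \<rightarrow>\<^sub>M count_space UNIV"
  unfolding path_space_def
  by (rule measurable_restrict_space1) (use assms in \<open>simp add: measurable_component_singleton\<close>)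

lemma space_path_filtration [simp]: "space (path_filtration t) = space path_space"
  by (simp add: path_filtration_def space_measure_of_conv)

lemma measurable_path_filtration_component:
  assumes "0 \<le> s" "s \<le> t"
  shows "(\<lambda>\<omega>. \<omega> s) \<in> path_filtration t \<rightarrow>\<^sub>M count_space UNIV"
proof (rule measurableI)
  fix A :: "nat set"
  have "{\<omega> \<in> space path_space. \<omega> s \<in> A} \<in> sets (path_filtration t)"
    unfolding path_filtration_def
    by (subst sets_measure_of) (use assms in \<open>auto intro!: sigma_sets.Basic\<close>)
  moreover have "(\<lambda>\<omega>. \<omega> s) -` A \<inter> space (path_filtration t) = {\<omega> \<in> space path_space. \<omega> s \<in> A}"
    by auto
  ultimately show "(\<lambda>\<omega>. \<omega> s) -` A \<inter> space (path_filtration t) \<in> sets (path_filtration t)"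
    by simp
qed simp

lemma cadlag_eventually_at_right:
  assumes "\<omega> \<in> cadlag" "0 \<le> t"
  obtains b where "t < b" "\<And>s. t < s \<Longrightarrow> s < b \<Longrightarrow> \<omega> s = \<omega> t"
proof -
  have "(\<omega> \<longlongrightarrow> \<omega> t) (at_right t)"
    using assms by (auto simp: cadlag_def continuous_within)
  then have "eventually (\<lambda>s. \<omega> s = \<omega> t) (at_right t)"
    by (simp add: tendsto_discrete)
  then show thesis
    using that by (auto simp: eventually_at_right_field)
qed

lemma cadlag_eventually_left_value:
  assumes "\<omega> \<in> cadlag" "0 < t"
  shows "eventually (\<lambda>s. \<omega> s = left_value \<omega> t) (at_left t)"
proof -
  obtain l where l: "(\<omega> \<longlongrightarrow> l) (at_left t)"
    using assms by (auto simp: cadlag_def)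
  then have "Lim (at_left t) \<omega> = l"
    by (intro tendsto_Lim) auto
  with l assms(2) show ?thesis
    by (simp add: left_value_def tendsto_discrete)
qed

text \<open>After each time the path is constant for a while, so no jump time lies in
  \<open>{t<..<b t}\<close>. These intervals, taken at the jump times, are disjoint, nonempty and
  open, hence countably many.\<close>

lemma cadlag_countable_jumps:
  assumes "\<omega> \<in> cadlag"
  shows "countable {t. 0 \<le> t \<and> left_value \<omega> t \<noteq> \<omega> t}" (is "countable ?D")
proof -
  have "\<exists>b>t. \<forall>s. t < s \<longrightarrow> s < b \<longrightarrow> \<omega> s = \<omega> t" if "0 \<le> t" for t
    using cadlag_eventually_at_right[OF assms that] by metis
  then obtain b where b: "\<And>t. 0 \<le> t \<Longrightarrow> t < b t"
      "\<And>t s. 0 \<le> t \<Longrightarrow> t < s \<Longrightarrow> s < b t \<Longrightarrow> \<omega> s = \<omega> t"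
    by metis
  have no_jump: "s \<notin> ?D" if "0 \<le> t" "t < s" "s < b t" for s t
  proof -
    have "eventually (\<lambda>r. \<omega> r = left_value \<omega> s) (at_left s)"
      using that by (intro cadlag_eventually_left_value[OF assms]) auto
    moreover have "eventually (\<lambda>r. r \<in> {t<..<s}) (at_left s)"
      by (rule eventually_at_leftI[OF _ \<open>t < s\<close>]) auto
    ultimately have "eventually (\<lambda>r. \<omega> s = left_value \<omega> s) (at_left s)"
      by eventually_elim (use b(2)[OF that(1)] that in auto)
    then show ?thesis by simp
  qed
  have "pairwise disjnt ((\<lambda>t. {t<..<b t}) ` ?D)"
  proof (rule pairwise_imageI)
    fix t s assume ts: "t \<in> ?D" "s \<in> ?D" "t \<noteq> s"
    have "\<not> (t < s \<and> s < b t)" "\<not> (s < t \<and> t < b s)"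
      using no_jump[of t s] no_jump[of s t] ts by auto
    then show "disjnt {t<..<b t} {s<..<b s}"
      using ts(3) by (auto simp: disjnt_iff)
  qed
  then have "countable ((\<lambda>t. {t<..<b t}) ` ?D)"
    by (intro countable_disjoint_open_subsets) auto
  moreover have "inj_on (\<lambda>t. {t<..<b t}) ?D"
  proof (rule inj_onI)
    fix t s assume ts: "t \<in> ?D" "s \<in> ?D" "{t<..<b t} = {s<..<b s}"
    then show "t = s"
      using b(1)[of t] b(1)[of s] by (metis (mono_tags, lifting) greaterThanLessThan_eq_iff leD mem_Collect_eq)
  qed
  ultimately show ?thesis
    by (rule countable_image_inj_on)
qed

section \<open>Joint measurability of the state in path and time\<close>

definition next_grid :: "nat \<Rightarrow> real \<Rightarrow> real" where
  "next_grid n x = (of_int \<lfloor>real (Suc n) * x\<rfloor> + 1) / real (Suc n)"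

lemma next_grid_bounds: "x < next_grid n x" "next_grid n x \<le> x + 1 / real (Suc n)"
proof -
  define m :: real where "m = real (Suc n)"
  have m: "m > 0" by (simp add: m_def)
  have "m * x < of_int \<lfloor>m * x\<rfloor> + 1" "of_int \<lfloor>m * x\<rfloor> \<le> m * x"
    by linarith+
  then have "x < (of_int \<lfloor>m * x\<rfloor> + 1) / m" "(of_int \<lfloor>m * x\<rfloor> + 1) / m \<le> x + 1 / m"
    using m by (simp_all add: field_simps)
  then show "x < next_grid n x" "next_grid n x \<le> x + 1 / real (Suc n)"
    by (simp_all only: next_grid_def m_def)
qed

lemma tendsto_next_grid: "(\<lambda>n. next_grid n x) \<longlonglongrightarrow> x"
proof (rule tendsto_sandwich[where f = "\<lambda>_. x" and h = "\<lambda>n. x + 1 / real (Suc n)"])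
  show "(\<lambda>n. x + 1 / real (Suc n)) \<longlonglongrightarrow> x"
    using tendsto_add[OF tendsto_const LIMSEQ_Suc[OF lim_1_over_n], of x] by simp
  show "eventually (\<lambda>n. x \<le> next_grid n x) sequentially"
    by (simp add: next_grid_bounds less_imp_le)
  show "eventually (\<lambda>n. next_grid n x \<le> x + 1 / real (Suc n)) sequentially"
    by (intro always_eventually allI next_grid_bounds)
qed simp

lemma cadlag_eventually_next_grid:
  assumes "\<omega> \<in> cadlag" "0 \<le> x" "x \<le> t"
  shows "eventually (\<lambda>n. \<omega> (min t (next_grid n x)) = \<omega> x) sequentially"
proof (cases "x = t")
  case True
  then have "min t (next_grid n x) = x" for n
    using next_grid_bounds(1)[of x n] by simp
  then show ?thesis by simp
next
  case False
  obtain b where b: "x < b" "\<And>s. x < s \<Longrightarrow> s < b \<Longrightarrow> \<omega> s = \<omega> x"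
    using cadlag_eventually_at_right[OF assms(1,2)] by blast
  have "eventually (\<lambda>n. next_grid n x < min b t) sequentially"
    by (rule order_tendstoD[OF tendsto_next_grid]) (use b(1) assms False in auto)
  then show ?thesis
  proof eventually_elim
    case (elim n)
    then show ?case using b(2)[of "next_grid n x"] next_grid_bounds(1)[of x n] by simp
  qed
qed

lemma measurable_eventually_const_limit:
  fixes f :: "nat \<Rightarrow> 'a \<Rightarrow> nat"
  assumes [measurable]: "\<And>n. f n \<in> N \<rightarrow>\<^sub>M count_space UNIV"
    and lim: "\<And>x. x \<in> space N \<Longrightarrow> eventually (\<lambda>n. f n x = g x) sequentially"
  shows "g \<in> N \<rightarrow>\<^sub>M count_space UNIV"
proof -
  have "g -` {k} \<inter> space N \<in> sets N" for k
  proof -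
    have "g x = k \<longleftrightarrow> eventually (\<lambda>n. f n x = k) sequentially" if x: "x \<in> space N" for x
    proof
      assume "eventually (\<lambda>n. f n x = k) sequentially"
      from this lim[OF x] have "eventually (\<lambda>n. g x = k) sequentially"
        by eventually_elim simp
      then show "g x = k" by simp
    qed (use lim[OF x] in simp)
    then have "g -` {k} \<inter> space N = {x \<in> space N. eventually (\<lambda>n. f n x = k) sequentially}"
      by auto
    also have "\<dots> \<in> sets N"
      unfolding eventually_sequentially by measurable
    finally show ?thesis .
  qed
  then show ?thesis
    by (simp add: measurable_count_space_eq2_countable)
qed

text \<open>By right continuity the state at a time is the eventual value at grid points to its
  right, and on each grid only countably many coordinates occur. Grid points are capped at
  \<open>t\<close>, so that only coordinates up to \<open>t\<close> are used and \<open>N\<close>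
  may be a member of the filtration.\<close>

lemma measurable_cadlag_jointly:
  assumes t: "0 \<le> t" and N: "space N \<subseteq> cadlag"
    and meas: "\<And>s. 0 \<le> s \<Longrightarrow> s \<le> t \<Longrightarrow> (\<lambda>\<omega>. \<omega> s) \<in> N \<rightarrow>\<^sub>M count_space UNIV"
  shows "(\<lambda>p. fst p (min t (max 0 (snd p)))) \<in> N \<Otimes>\<^sub>M borel \<rightarrow>\<^sub>M count_space UNIV"
proof (rule measurable_eventually_const_limit
    [where f = "\<lambda>n p. fst p (max 0 (min t (next_grid n (min t (max 0 (snd p))))))"])
  fix n :: nat
  define k where "k p = \<lfloor>real (Suc n) * min t (max 0 (snd p))\<rfloor>" for p :: "(real \<Rightarrow> nat) \<times> real"
  \<comment> \<open>The outer \<open>max 0\<close> matters only for integers \<open>z\<close> that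
    \<open>k\<close> never takes: there the grid point may be negative, where the coordinate is not
    known to be measurable.\<close>
  have "(\<lambda>p. (\<lambda>z p. fst p (max 0 (min t ((of_int z + 1) / real (Suc n))))) (k p) p)
    \<in> N \<Otimes>\<^sub>M borel \<rightarrow>\<^sub>M count_space UNIV"
  proof (rule measurable_compose_countable[where g = k])
    fix z :: int
    show "(\<lambda>p. fst p (max 0 (min t ((real_of_int z + 1) / real (Suc n)))))
        \<in> N \<Otimes>\<^sub>M borel \<rightarrow>\<^sub>M count_space UNIV"
      by (rule measurable_compose[OF measurable_fst meas]) (use t in auto)
    show "k \<in> N \<Otimes>\<^sub>M borel \<rightarrow>\<^sub>M count_space UNIV"
      unfolding k_def by measurable
  qed
  then show "(\<lambda>p. fst p (max 0 (min t (next_grid n (min t (max 0 (snd p)))))))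
    \<in> N \<Otimes>\<^sub>M borel \<rightarrow>\<^sub>M count_space UNIV"
    unfolding next_grid_def k_def .
next
  fix p :: "(real \<Rightarrow> nat) \<times> real" assume "p \<in> space (N \<Otimes>\<^sub>M borel)"
  then have p: "fst p \<in> cadlag" using N by (auto simp: space_pair_measure)
  define x where "x = min t (max 0 (snd p))"
  have x: "0 \<le> x" "x \<le> t" using t by (auto simp: x_def)
  have "max 0 (min t (next_grid n x)) = min t (next_grid n x)" for n
    using next_grid_bounds(1)[of x n] x t by simp
  then show "\<forall>\<^sub>F n in sequentially. fst p (max 0 (min t (next_grid n (min t (max 0 (snd p))))))
      = fst p (min t (max 0 (snd p)))"
    using cadlag_eventually_next_grid[OF p x] by (simp add: x_def)
qed

section \<open>Bounded transition rates\<close>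

locale jump_rates =
  fixes U :: "nat \<Rightarrow> 'u set"
    and d :: "nat \<Rightarrow> 'u \<Rightarrow> 'u \<Rightarrow> real"
    and lam :: "nat \<Rightarrow> nat \<Rightarrow> 'u \<Rightarrow> real"
    and M :: real
  assumes U_nonempty: "\<And>i. U i \<noteq> {}"
    and U_metric: "\<And>i. Metric_space (U i) (d i)"
    and U_compact: "\<And>i. compact_space (Metric_space.mtopology (U i) (d i))"
    and rates_nonneg: "\<And>i j v. j \<noteq> i \<Longrightarrow> v \<in> U i \<Longrightarrow> 0 \<le> lam i j v"
    and rates_diag: "\<And>i v. v \<in> U i \<Longrightarrow> lam i i v = - (\<Sum>j. if j = i then 0 else lam i j v)"
    and rates_cont: "\<And>i j. j \<noteq> i \<Longrightarrow>
      continuous_map (Metric_space.mtopology (U i) (d i)) euclideanreal (lam i j)"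
    and exit_rate_le: "\<And>i v. v \<in> U i \<Longrightarrow> - lam i i v \<le> M"
    and exit_rate_uniform: "\<And>i. uniformly_convergent_on (U i)
      (\<lambda>n v. \<Sum>j<n. if j = i then 0 else lam i j v)"
begin

abbreviation topo :: "nat \<Rightarrow> 'u topology" where
  "topo i \<equiv> Metric_space.mtopology (U i) (d i)"

lemma topspace_topo [simp]: "topspace (topo i) = U i"
  by (rule Metric_space.topspace_mtopology[OF U_metric])

lemma summable_off_diag:
  assumes "v \<in> U i"
  shows "summable (\<lambda>j. if j = i then 0 else lam i j v)"
  using uniformly_convergent_imp_convergent[OF exit_rate_uniform assms]
  by (simp add: summable_iff_convergent)

lemma off_diag_sums:
  assumes "v \<in> U i"
  shows "(\<lambda>j. if j = i then 0 else lam i j v) sums (- lam i i v)"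
  using summable_off_diag[OF assms] rates_diag[OF assms] by (simp add: sums_iff)

text \<open>The off-diagonal rates and the modulus of the diagonal one contribute
  \<open>- lam i i v\<close> each. This is the origin of the factor \<open>2 * M\<close> in all
  later bounds on the generator.\<close>

lemma rates_abs_sums:
  assumes "v \<in> U i"
  shows "(\<lambda>j. \<bar>lam i j v\<bar>) sums (- 2 * lam i i v)"
proof -
  have "0 \<le> - lam i i v"
    by (rule sums_le[OF _ sums_zero off_diag_sums[OF assms]]) (simp add: rates_nonneg[OF _ assms])
  then have abs_eq: "\<bar>lam i i v\<bar> = - lam i i v" by simp
  have "(\<lambda>j. (if j = i then 0 else lam i j v) + (if j = i then \<bar>lam i j v\<bar> else 0))
      sums (- lam i i v + \<bar>lam i i v\<bar>)"
    by (intro sums_add off_diag_sums[OF assms] sums_single)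
  moreover have "(\<lambda>j. (if j = i then 0 else lam i j v) + (if j = i then \<bar>lam i j v\<bar> else 0)) =
      (\<lambda>j. \<bar>lam i j v\<bar>)"
    using rates_nonneg[OF _ assms] by (intro ext) simp
  ultimately show ?thesis by (simp add: abs_eq)
qed

lemma lam_diag_nonpos:
  assumes "v \<in> U i"
  shows "lam i i v \<le> 0"
  using sums_le[OF _ sums_zero rates_abs_sums[OF assms]] by simp

lemma M_nonneg: "0 \<le> M"
proof -
  obtain v where v: "v \<in> U 0" using U_nonempty by blast
  show ?thesis using lam_diag_nonpos[OF v] exit_rate_le[OF v] by simp
qed

lemma lam_off_diag_le:
  assumes "v \<in> U i" "j \<noteq> i"
  shows "lam i j v \<le> M"
proof -
  have "(\<Sum>k\<in>{j}. if k = i then 0 else lam i k v) \<le> (\<Sum>k. if k = i then 0 else lam i k v)"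
    using summable_off_diag[OF assms(1)] rates_nonneg[OF _ assms(1)]
    by (intro sum_le_suminf) auto
  then show ?thesis
    using assms(2) rates_diag[OF assms(1)] exit_rate_le[OF assms(1)] by simp
qed

lemma lam_abs_le:
  assumes "v \<in> U i"
  shows "\<bar>lam i j v\<bar> \<le> M"
  using lam_off_diag_le[OF assms, of j] lam_diag_nonpos[OF assms] exit_rate_le[OF assms]
    rates_nonneg[OF _ assms, of j] by (cases "j = i") auto

lemma lam_ge:
  assumes "v \<in> U i"
  shows "- M \<le> lam i j v"
  using lam_abs_le[OF assms, of j] by linarith

lemma rate_sum_bounded:
  assumes v: "v \<in> U i" and f: "\<And>j. \<bar>f j\<bar> \<le> b"
  shows "summable (\<lambda>j. lam i j v * f j)" "\<bar>\<Sum>j. lam i j v * f j\<bar> \<le> 2 * M * b"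
proof -
  have b: "0 \<le> b" using f[of 0] by linarith
  have s: "(\<lambda>j. \<bar>lam i j v\<bar> * b) sums (- 2 * lam i i v * b)"
    by (rule sums_mult2[OF rates_abs_sums[OF v]])
  have le: "norm (lam i j v * f j) \<le> \<bar>lam i j v\<bar> * b" for j
    using f[of j] by (simp add: abs_mult mult_left_mono)
  show sm: "summable (\<lambda>j. lam i j v * f j)"
    by (rule summable_comparison_test'[OF sums_summable[OF s] le])
  have "\<bar>\<Sum>j. lam i j v * f j\<bar> \<le> (\<Sum>j. \<bar>lam i j v\<bar> * b)"
    using norm_suminf_le[OF le sums_summable[OF s]] by simp
  also have "\<dots> = - 2 * lam i i v * b"
    using s by (rule sums_unique[symmetric])
  also have "\<dots> \<le> 2 * M * b"
    using exit_rate_le[OF v] b by (intro mult_right_mono) auto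
  finally show "\<bar>\<Sum>j. lam i j v * f j\<bar> \<le> 2 * M * b" .
qed

lemma rate_sum_diff_bounded:
  assumes v: "v \<in> U i" and f: "\<And>j. \<bar>f j\<bar> \<le> b" and g: "\<And>j. \<bar>g j\<bar> \<le> b"
    and fg: "\<And>j. \<bar>f j - g j\<bar> \<le> e"
  shows "\<bar>(\<Sum>j. lam i j v * f j) - (\<Sum>j. lam i j v * g j)\<bar> \<le> 2 * M * e"
proof -
  have "(\<Sum>j. lam i j v * f j) - (\<Sum>j. lam i j v * g j) = (\<Sum>j. lam i j v * (f j - g j))"
    using suminf_diff[OF rate_sum_bounded(1)[OF v f] rate_sum_bounded(1)[OF v g]]
    by (simp add: right_diff_distrib)
  then show ?thesis
    using rate_sum_bounded(2)[OF v fg] by simp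
qed

text \<open>The partial sums are continuous and converge uniformly: off-diagonal rates are
  nonnegative, so the remainder is at most \<open>b\<close> times the tail of the exit rate, which
  is uniformly small by (A3).\<close>

lemma continuous_map_off_diag_sum:
  assumes f: "\<And>j. \<bar>f j\<bar> \<le> b"
  shows "continuous_map (topo i) euclideanreal (\<lambda>v. \<Sum>j. if j = i then 0 else lam i j v * f j)"
proof -
  let ?a = "\<lambda>j v. if j = i then 0 else lam i j v"
  have b: "0 \<le> b" using f[of 0] by linarith
  have sm: "summable (\<lambda>j. ?a j v * f j)" if "v \<in> U i" for v
  proof (rule summable_comparison_test')
    show "summable (\<lambda>j. ?a j v * b)" by (rule summable_mult2[OF summable_off_diag[OF that]])
    show "norm (?a j v * f j) \<le> ?a j v * b" for j
      using f[of j] rates_nonneg[OF _ that, of j] by (auto simp: abs_mult intro: mult_left_mono)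
  qed
  have "continuous_map (topo i) Met_TC.mtopology (\<lambda>v. \<Sum>j. ?a j v * f j)"
  proof (rule Met_TC.continuous_map_uniform_limit[where F = sequentially])
    show "\<forall>\<^sub>F n in sequentially. continuous_map (topo i) Met_TC.mtopology (\<lambda>v. \<Sum>j<n. ?a j v * f j)"
    proof (intro always_eventually allI)
      fix n
      have "continuous_map (topo i) euclideanreal (\<lambda>v. ?a j v * f j)" for j
        using rates_cont[of j i] by (cases "j = i") (auto intro!: continuous_map_real_mult)
      then show "continuous_map (topo i) Met_TC.mtopology (\<lambda>v. \<Sum>j<n. ?a j v * f j)"
        by (auto intro!: continuous_map_sum)
    qed
    fix e :: real assume e: "0 < e"
    have lim: "uniform_limit (U i) (\<lambda>n v. \<Sum>j<n. ?a j v) (\<lambda>v. \<Sum>j. ?a j v) sequentially"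
      using exit_rate_uniform[of i]
      by (simp add: uniformly_convergent_uniform_limit_iff suminf_eq_lim)
    \<comment> \<open>The \<open>+ 1\<close> admits \<open>b = 0\<close> and makes the final
      estimate \<open>e / (b + 1) * b < e\<close> strict.\<close>
    have "e / (b + 1) > 0" using e b by simp
    from uniform_limitD[OF lim this]
    show "\<forall>\<^sub>F n in sequentially. \<forall>v\<in>topspace (topo i). (\<Sum>j. ?a j v * f j) \<in> UNIV \<and>
        dist (\<Sum>j<n. ?a j v * f j) (\<Sum>j. ?a j v * f j) < e"
    proof eventually_elim
      case (elim n)
      have "dist (\<Sum>j<n. ?a j v * f j) (\<Sum>j. ?a j v * f j) < e" if v: "v \<in> U i" for v
      proof -
        note s = summable_off_diag[OF v]
        have tail: "\<bar>\<Sum>j. ?a (j + n) v\<bar> < e / (b + 1)"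
          using elim v suminf_minus_initial_segment[OF s, of n] by (auto simp: dist_real_def)
        have "norm (\<Sum>j. ?a (j + n) v * f (j + n)) \<le> (\<Sum>j. ?a (j + n) v * b)"
        proof (rule norm_suminf_le)
          show "norm (?a (j + n) v * f (j + n)) \<le> ?a (j + n) v * b" for j
            using f[of "j + n"] rates_nonneg[OF _ v, of "j + n"]
            by (auto simp: abs_mult intro: mult_left_mono)
          show "summable (\<lambda>j. ?a (j + n) v * b)"
            by (intro summable_mult2) (rule summable_ignore_initial_segment[OF s])
        qed
        also have "\<dots> = (\<Sum>j. ?a (j + n) v) * b"
          by (rule suminf_mult2[symmetric, OF summable_ignore_initial_segment[OF s]])
        also have "\<dots> \<le> e / (b + 1) * b"
          using tail b by (intro mult_right_mono) auto
        also have "\<dots> < e"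
          using e b by (simp add: field_simps)
        finally show ?thesis
          using suminf_minus_initial_segment[OF sm[OF v], of n] by (simp add: dist_real_def)
      qed
      then show ?case by simp
    qed
  qed simp
  then show ?thesis by (simp add: if_distrib if_distribR cong: if_cong)
qed

text \<open>The diagonal rate is minus the off-diagonal sum with constant weight
  \<open>1\<close>.\<close>

lemma continuous_map_lam: "continuous_map (topo i) euclideanreal (lam i j)"
proof (cases "j = i")
  case True
  have "continuous_map (topo i) euclideanreal (\<lambda>v. - (\<Sum>j. if j = i then 0 else lam i j v * 1))"
    by (intro continuous_map_minus continuous_map_off_diag_sum[where b = 1]) simp
  then show ?thesis
    by (rule continuous_map_eq) (simp add: True rates_diag cong: if_cong)
qed (rule rates_cont)

lemma continuous_map_rate_sum:
  assumes f: "\<And>j. \<bar>f j\<bar> \<le> b"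
  shows "continuous_map (topo i) euclideanreal (\<lambda>v. \<Sum>j. lam i j v * f j)"
proof -
  have split: "(\<Sum>j. lam i j v * f j) = lam i i v * f i + (\<Sum>j. if j = i then 0 else lam i j v * f j)"
    if v: "v \<in> U i" for v
  proof -
    have s: "summable (\<lambda>j. lam i j v * f j)" by (rule rate_sum_bounded(1)[OF v f])
    have "(\<lambda>j. lam i j v * f j - (if j = i then lam i j v * f j else 0)) sums
        ((\<Sum>j. lam i j v * f j) - lam i i v * f i)"
      by (intro sums_diff summable_sums[OF s] sums_single)
    moreover have "lam i j v * f j - (if j = i then lam i j v * f j else 0) =
        (if j = i then 0 else lam i j v * f j)" for j
      by simp
    ultimately show ?thesis by (simp add: sums_iff)
  qed
  have "continuous_map (topo i) euclideanreal
      (\<lambda>v. lam i i v * f i + (\<Sum>j. if j = i then 0 else lam i j v * f j))"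
    by (intro continuous_map_add continuous_map_real_mult continuous_map_lam
        continuous_map_off_diag_sum[OF f]) simp
  then show ?thesis
    by (rule continuous_map_eq) (simp add: split)
qed

section \<open>Measurability along a control\<close>

lemma borel_measurable_control:
  assumes "u \<in> markov_controls U d" and g: "continuous_map (topo k) euclideanreal g"
  shows "(\<lambda>t. g (u t k)) \<in> borel_measurable (restrict_space borel {0..})"
proof -
  have "(\<lambda>t. u t k) \<in> restrict_space borel {0..} \<rightarrow>\<^sub>M action_borel U d k"
    using assms(1) by (simp add: markov_controls_def)
  moreover have "g \<in> borel_measurable (action_borel U d k)"
    unfolding action_borel_def by (rule borel_measurable_continuous_map[OF g])
  ultimately show ?thesis by (rule measurable_compose)
qed

lemma control_in_U:
  assumes "u \<in> markov_controls U d" "0 \<le> t"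
  shows "u t k \<in> U k"
proof -
  have "(\<lambda>t. u t k) \<in> restrict_space borel {0..} \<rightarrow>\<^sub>M action_borel U d k"
    using assms(1) by (simp add: markov_controls_def)
  from measurable_space[OF this, of t] assms(2) show ?thesis
    by (simp add: action_borel_def space_restrict_space)
qed

end

section \<open>Controlled laws\<close>

lemma set_integral_Icc_ge:
  fixes f :: "real \<Rightarrow> real"
  assumes "s \<le> t" "set_integrable lborel {s..t} f" "\<And>r. s \<le> r \<Longrightarrow> r \<le> t \<Longrightarrow> b \<le> f r"
  shows "b * (t - s) \<le> (LINT r:{s..t}|lborel. f r)"
proof -
  have "set_integrable lborel {s..t} (\<lambda>_. b)"
    unfolding set_integrable_def by (intro integrable_scaleR_left integrable_real_indicator)
      (auto simp: emeasure_lborel_Icc_eq)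
  then have "(LINT r:{s..t}|lborel. b) \<le> (LINT r:{s..t}|lborel. f r)"
    using assms by (intro set_integral_mono) auto
  then show ?thesis using assms(1) by (simp add: set_lebesgue_integral_def mult.commute)
qed

lemma set_integral_Icc_abs_le:
  fixes f :: "real \<Rightarrow> real"
  assumes "s \<le> t" "set_integrable lborel {s..t} f" "\<And>r. s \<le> r \<Longrightarrow> r \<le> t \<Longrightarrow> \<bar>f r\<bar> \<le> b"
  shows "\<bar>LINT r:{s..t}|lborel. f r\<bar> \<le> b * (t - s)"
proof -
  have "- b * (t - s) \<le> (LINT r:{s..t}|lborel. f r)"
    using assms(3) by (intro set_integral_Icc_ge assms(1,2)) (auto simp: abs_le_iff minus_le_iff)
  moreover have "set_integrable lborel {s..t} (\<lambda>r. - f r)"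
    using assms(2) unfolding set_integrable_def by simp
  then have "- b * (t - s) \<le> (LINT r:{s..t}|lborel. - f r)"
    using assms(3) by (intro set_integral_Icc_ge assms(1)) (auto simp: abs_le_iff)
  ultimately show ?thesis
    using set_integral_uminus[OF assms(2)] by simp
qed

lemma set_integral_Icc_split:
  fixes f :: "real \<Rightarrow> real"
  assumes "0 \<le> s" "s \<le> t" "set_integrable lborel {0..s} f" "set_integrable lborel {s..t} f"
  shows "(LINT r:{0..t}|lborel. f r) = (LINT r:{0..s}|lborel. f r) + (LINT r:{s..t}|lborel. f r)"
proof -
  have "{0..t} = {0..s} \<union> {s..t}" using assms by auto
  moreover have ae: "AE r in lborel. \<not> (r \<in> {0..s} \<and> r \<in> {s..t})"
    using AE_lborel_singleton[of s] by eventually_elim auto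
  ultimately show ?thesis
    using set_integral_Un_AE[OF ae _ _ assms(3,4)] by simp
qed

text \<open>\<open>N\<close> is left open for two uses: with \<open>path_filtration t\<close> it
  makes the accumulated cost adapted, and with the discrete space on a single path it gives
  measurability in time along that path.\<close>

lemma measurable_path_function:
  fixes g :: "nat \<Rightarrow> real \<Rightarrow> real"
  assumes s: "0 \<le> s" "s \<le> t" and N: "space N \<subseteq> cadlag"
    and meas: "\<And>s. 0 \<le> s \<Longrightarrow> s \<le> t \<Longrightarrow> (\<lambda>\<omega>. \<omega> s) \<in> N \<rightarrow>\<^sub>M count_space UNIV"
    and g: "\<And>k. g k \<in> borel_measurable (restrict_space borel {0..})"
  shows "(\<lambda>p. indicator {s..t} (snd p) * g (fst p (snd p)) (snd p)) \<in> borel_measurable (N \<Otimes>\<^sub>M lborel)"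
proof -
  have g': "(\<lambda>r. indicator {0..} r * g k r) \<in> borel_measurable borel" for k
    using g[of k] by (simp add: borel_measurable_restrict_space_iff)
  have joint: "(\<lambda>p. fst p (min t (max 0 (snd p)))) \<in> N \<Otimes>\<^sub>M borel \<rightarrow>\<^sub>M count_space UNIV"
    using s by (intro measurable_cadlag_jointly N meas) auto
  have "(\<lambda>p. indicator {s..t} (snd p) * (indicator {0..} (snd p) *
      g (fst p (min t (max 0 (snd p)))) (snd p))) \<in> borel_measurable (N \<Otimes>\<^sub>M borel)"
  proof (rule measurable_compose_countable[where g = "\<lambda>p. fst p (min t (max 0 (snd p)))"
        and f = "\<lambda>k p. indicator {s..t} (snd p) * (indicator {0..} (snd p) * g k (snd p))"])
    show "(\<lambda>p. indicator {s..t} (snd p) * (indicator {0..} (snd p) * g k (snd p)))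
        \<in> borel_measurable (N \<Otimes>\<^sub>M borel)" for k
      by (intro borel_measurable_times measurable_compose[OF measurable_snd g']
          measurable_compose[OF measurable_snd borel_measurable_indicator]) simp
  qed (rule joint)
  moreover have "(\<lambda>p. indicator {s..t} (snd p) * (indicator {0..} (snd p) *
      g (fst p (min t (max 0 (snd p)))) (snd p))) =
      (\<lambda>p. indicator {s..t} (snd p) * g (fst p (snd p)) (snd p))"
    using s by (auto simp: fun_eq_iff indicator_def)
  ultimately have "(\<lambda>p. indicator {s..t} (snd p) * g (fst p (snd p)) (snd p))
      \<in> borel_measurable (N \<Otimes>\<^sub>M borel)"
    by simp
  then show ?thesis by measurable
qed

lemma borel_measurable_path_integral:
  fixes g :: "nat \<Rightarrow> real \<Rightarrow> real"
  assumes "0 \<le> s" "s \<le> t" "space N \<subseteq> cadlag"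
    and "\<And>s. 0 \<le> s \<Longrightarrow> s \<le> t \<Longrightarrow> (\<lambda>\<omega>. \<omega> s) \<in> N \<rightarrow>\<^sub>M count_space UNIV"
    and "\<And>k. g k \<in> borel_measurable (restrict_space borel {0..})"
  shows "(\<lambda>\<omega>. LINT r:{s..t}|lborel. g (\<omega> r) r) \<in> borel_measurable N"
  unfolding set_lebesgue_integral_def
  by (rule lborel.borel_measurable_lebesgue_integral)
    (use measurable_path_function[OF assms] in \<open>simp add: case_prod_beta\<close>)

lemma set_integrable_path:
  fixes g :: "nat \<Rightarrow> real \<Rightarrow> real"
  assumes \<omega>: "\<omega> \<in> cadlag" and s: "0 \<le> s"
    and g: "\<And>k. g k \<in> borel_measurable (restrict_space borel {0..})"
    and bound: "\<And>k r. 0 \<le> r \<Longrightarrow> \<bar>g k r\<bar> \<le> b"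
  shows "set_integrable lborel {s..t} (\<lambda>r. g (\<omega> r) r)"
proof (cases "s \<le> t")
  case True
  have "(\<lambda>p. indicator {s..t} (snd p) * g (fst p (snd p)) (snd p))
      \<in> borel_measurable (count_space {\<omega>} \<Otimes>\<^sub>M lborel)"
    using \<omega> by (intro measurable_path_function[OF s True _ _ g]) auto
  from measurable_Pair2[OF this, of \<omega>]
  have meas: "(\<lambda>r. indicator {s..t} r * g (\<omega> r) r) \<in> borel_measurable lborel"
    by simp
  show ?thesis
    unfolding set_integrable_def
  proof (rule integrableI_bounded_set)
    show "AE r in lborel. r \<in> {s..t} \<longrightarrow> norm (indicator {s..t} r *\<^sub>R g (\<omega> r) r) \<le> b"
      using bound s by auto
    show "emeasure lborel {s..t} < \<infinity>" by (simp add: emeasure_lborel_Icc_eq)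
  qed (use meas in auto)
qed (simp add: set_integrable_def)

section \<open>The controlled process and its jumps over short times\<close>

locale controlled_law = jump_rates U d lam M
  for U :: "nat \<Rightarrow> 'u set" and d lam M +
  fixes u :: "real \<Rightarrow> nat \<Rightarrow> 'u" and x0 :: nat and Q :: "(real \<Rightarrow> nat) measure"
  assumes control: "u \<in> markov_controls U d"
    and law: "solves_martingale_problem lam u x0 Q"
begin

sublocale prob_space Q
  using law by (simp add: solves_martingale_problem_def)

lemma sets_Q: "sets Q = sets path_space"
  using law by (simp add: solves_martingale_problem_def)

lemma space_Q: "space Q = space path_space"
  by (rule sets_eq_imp_space_eq[OF sets_Q])

lemma path_cadlag: "\<omega> \<in> space Q \<Longrightarrow> \<omega> \<in> cadlag"
  by (simp add: space_Q space_path_space)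

lemma AE_start: "AE \<omega> in Q. \<omega> 0 = x0"
  using law by (simp add: solves_martingale_problem_def)

lemma martingale:
  assumes "\<And>j. \<bar>f j\<bar> \<le> (b :: real)"
  shows "is_martingale Q path_filtration
    (\<lambda>t \<omega>. f (\<omega> t) - (LINT r:{0..t}|lborel. generator lam u r f (\<omega> r)))"
proof -
  have "bounded (range f)"
    using assms by (auto simp: bounded_iff intro!: exI[of _ b])
  then show ?thesis
    using law by (simp add: solves_martingale_problem_def)
qed

lemma subalgebra_path_filtration:
  assumes "0 \<le> t"
  shows "subalgebra Q (path_filtration t)"
  using martingale[of "\<lambda>_. 0" 0] assms by (simp add: is_martingale_def)

lemma borel_measurable_from_filtration:
  "0 \<le> t \<Longrightarrow> f \<in> borel_measurable (path_filtration t) \<Longrightarrow> f \<in> borel_measurable Q"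
  by (rule measurable_from_subalg[OF subalgebra_path_filtration])

lemma measurable_state: "0 \<le> t \<Longrightarrow> (\<lambda>\<omega>. \<omega> t) \<in> Q \<rightarrow>\<^sub>M count_space UNIV"
  using measurable_path_space_component by (simp add: measurable_cong_sets[OF sets_Q refl])

lemma borel_measurable_state:
  "0 \<le> t \<Longrightarrow> (\<lambda>\<omega>. f (\<omega> t)) \<in> borel_measurable Q"
  by (rule measurable_compose[OF measurable_state]) auto

lemma borel_measurable_rate: "(\<lambda>r. lam k j (u r k)) \<in> borel_measurable (restrict_space borel {0..})"
  by (rule borel_measurable_control[OF control continuous_map_lam])

lemma borel_measurable_generator:
  assumes "\<And>j. (\<lambda>r. f r j) \<in> borel_measurable (restrict_space borel {0..})"
  shows "(\<lambda>r. generator lam u r (f r) k) \<in> borel_measurable (restrict_space borel {0..})"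
  unfolding generator_def
  by (intro borel_measurable_suminf borel_measurable_times borel_measurable_rate assms)

lemma generator_bound:
  assumes "\<And>j. \<bar>f j\<bar> \<le> b" "0 \<le> r"
  shows "\<bar>generator lam u r f k\<bar> \<le> 2 * M * b"
  unfolding generator_def by (rule rate_sum_bounded(2)[OF control_in_U[OF control]]) (use assms in auto)

lemma set_integrable_generator:
  assumes "\<omega> \<in> space Q" "\<And>j. \<bar>f j\<bar> \<le> b" "0 \<le> s"
  shows "set_integrable lborel {s..t} (\<lambda>r. generator lam u r f (\<omega> r))"
  using assms borel_measurable_generator[of "\<lambda>_. f"] generator_bound[of f b]
  by (intro set_integrable_path[where g = "\<lambda>k r. generator lam u r f k"] path_cadlag) auto

lemma generator_integral_split:
  assumes "\<omega> \<in> space Q" "\<And>j. \<bar>f j\<bar> \<le> b" "0 \<le> s" "s \<le> t"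
  shows "(LINT r:{0..t}|lborel. generator lam u r f (\<omega> r)) =
    (LINT r:{0..s}|lborel. generator lam u r f (\<omega> r)) + (LINT r:{s..t}|lborel. generator lam u r f (\<omega> r))"
  by (intro set_integral_Icc_split set_integrable_generator[OF assms(1,2)] assms(3,4) order_refl)

text \<open>The factor \<open>Y\<close>, known at time \<open>s\<close>, can be moved inside the
  conditional expectation given \<open>path_filtration s\<close>. It serves to localize to an event
  at time \<open>s\<close> and to carry the exponential weight accumulated so far.\<close>

lemma martingale_increment:
  assumes f: "\<And>j. \<bar>f j\<bar> \<le> b" and st: "0 \<le> s" "s \<le> t"
    and Y: "Y \<in> borel_measurable (path_filtration s)" "\<And>\<omega>. \<omega> \<in> space Q \<Longrightarrow> \<bar>Y \<omega>\<bar> \<le> y"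
  shows "integrable Q (\<lambda>\<omega>. Y \<omega> * (f (\<omega> t) - f (\<omega> s) - (LINT r:{s..t}|lborel. generator lam u r f (\<omega> r))))"
    and "(\<integral>\<omega>. Y \<omega> * (f (\<omega> t) - f (\<omega> s) - (LINT r:{s..t}|lborel. generator lam u r f (\<omega> r))) \<partial>Q) = 0"
proof -
  define Z where "Z t \<omega> = f (\<omega> t) - (LINT r:{0..t}|lborel. generator lam u r f (\<omega> r))" for t \<omega>
  have mart: "is_martingale Q path_filtration Z"
    using martingale[OF f] unfolding Z_def .
  have Ym: "Y \<in> borel_measurable Q"
    by (rule borel_measurable_from_filtration[OF st(1) Y(1)])
  have Zint: "integrable Q (Z r)" if "0 \<le> r" for r
    using mart that by (simp add: is_martingale_def)
  have YZ: "integrable Q (\<lambda>\<omega>. Y \<omega> * Z r \<omega>)" if "0 \<le> r" for r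
  proof (rule Bochner_Integration.integrable_bound)
    show "integrable Q (\<lambda>\<omega>. y * Z r \<omega>)" using Zint[OF that] by simp
    show "(\<lambda>\<omega>. Y \<omega> * Z r \<omega>) \<in> borel_measurable Q"
      using Ym Zint[OF that] by simp
    have "\<bar>Y \<omega> * Z r \<omega>\<bar> \<le> \<bar>y * Z r \<omega>\<bar>" if "\<omega> \<in> space Q" for \<omega>
      using Y(2)[OF that] by (auto simp: abs_mult intro!: mult_right_mono)
    then show "AE \<omega> in Q. norm (Y \<omega> * Z r \<omega>) \<le> norm (y * Z r \<omega>)"
      by simp
  qed
  interpret S: finite_measure_subalgebra Q "path_filtration s"
    by unfold_locales (rule subalgebra_path_filtration[OF st(1)])
  have t: "0 \<le> t" using st by simp
  have "(\<integral>\<omega>. Y \<omega> * Z t \<omega> \<partial>Q) = (\<integral>\<omega>. Y \<omega> * real_cond_exp Q (path_filtration s) (Z t) \<omega> \<partial>Q)"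
    using Zint[OF t] by (intro S.real_cond_exp_intg(2)[symmetric] YZ[OF t] Y(1)) simp
  also have "\<dots> = (\<integral>\<omega>. Y \<omega> * Z s \<omega> \<partial>Q)"
  proof (rule integral_cong_AE)
    have "AE \<omega> in Q. real_cond_exp Q (path_filtration s) (Z t) \<omega> = Z s \<omega>"
      using mart st by (simp add: is_martingale_def)
    then show "AE \<omega> in Q. Y \<omega> * real_cond_exp Q (path_filtration s) (Z t) \<omega> = Y \<omega> * Z s \<omega>"
      by eventually_elim simp
  qed (use Ym Zint[OF st(1)] in auto)
  finally have eq: "(\<integral>\<omega>. Y \<omega> * Z t \<omega> - Y \<omega> * Z s \<omega> \<partial>Q) = 0"
    using YZ st t by simp
  have incr: "Y \<omega> * (f (\<omega> t) - f (\<omega> s) - (LINT r:{s..t}|lborel. generator lam u r f (\<omega> r))) =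
      Y \<omega> * Z t \<omega> - Y \<omega> * Z s \<omega>" if "\<omega> \<in> space Q" for \<omega>
    using generator_integral_split[OF that f st] by (simp add: Z_def algebra_simps)
  show "integrable Q (\<lambda>\<omega>. Y \<omega> * (f (\<omega> t) - f (\<omega> s) - (LINT r:{s..t}|lborel. generator lam u r f (\<omega> r))))"
    using YZ st t by (simp add: incr cong: Bochner_Integration.integrable_cong)
  show "(\<integral>\<omega>. Y \<omega> * (f (\<omega> t) - f (\<omega> s) - (LINT r:{s..t}|lborel. generator lam u r f (\<omega> r))) \<partial>Q) = 0"
    using eq by (simp add: incr cong: Bochner_Integration.integral_cong)
qed

text \<open>The test function is the indicator of \<open>j\<close>, weighted by the event of being
  in \<open>j\<close> at time \<open>s\<close>. Its generator is the rate into \<open>j\<close>,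
  which is at least \<open>- M\<close> in every state. Keeping the probability of the starting state
  on the right lets the bounds be summed over \<open>j\<close> afterwards; a direct test for a jump
  is impossible, since the test function would depend on the state at time \<open>s\<close>.\<close>

lemma prob_leave_le:
  assumes st: "0 \<le> s" "s \<le> t"
  shows "prob {\<omega> \<in> space Q. \<omega> s = j \<and> \<omega> t \<noteq> j} \<le> M * (t - s) * prob {\<omega> \<in> space Q. \<omega> s = j}"
proof -
  define f :: "nat \<Rightarrow> real" where "f k = (if k = j then 1 else 0)" for k
  define Y :: "(real \<Rightarrow> nat) \<Rightarrow> real" where "Y \<omega> = f (\<omega> s)" for \<omega>
  let ?D = "{\<omega> \<in> space Q. \<omega> s = j \<and> \<omega> t \<noteq> j}" and ?E = "{\<omega> \<in> space Q. \<omega> s = j}"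
  have t: "0 \<le> t" using st by simp
  note [measurable] = measurable_state[OF st(1)] measurable_state[OF t]
  have DE: "?D \<in> events" "?E \<in> events" by measurable
  have f: "\<bar>f k\<bar> \<le> 1" for k by (simp add: f_def)
  have gen: "generator lam u r f k = lam k j (u r k)" for r k
  proof -
    have "(\<lambda>l. if l = j then lam k l (u r k) else 0) sums lam k j (u r k)"
      by (rule sums_single)
    moreover have "(\<lambda>l. lam k l (u r k) * f l) = (\<lambda>l. if l = j then lam k l (u r k) else 0)"
      by (auto simp: f_def)
    ultimately show ?thesis by (simp add: generator_def sums_iff)
  qed
  have Ym: "Y \<in> borel_measurable (path_filtration s)"
    unfolding Y_def by (rule measurable_compose[OF measurable_path_filtration_component[OF st(1) order_refl]]) simp
  let ?I = "\<lambda>\<omega>. LINT r:{s..t}|lborel. generator lam u r f (\<omega> r)"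
  have Yb: "\<bar>Y \<omega>\<bar> \<le> 1" for \<omega> using f by (simp add: Y_def)
  note inc = martingale_increment[of f, OF f st Ym Yb]
  have "0 = (\<integral>\<omega>. Y \<omega> * (f (\<omega> t) - f (\<omega> s) - ?I \<omega>) \<partial>Q)"
    using inc(2) by simp
  also have "\<dots> \<le> (\<integral>\<omega>. M * (t - s) * indicator ?E \<omega> - indicator ?D \<omega> \<partial>Q)"
  proof (rule integral_mono[OF inc(1)])
    show "integrable Q (\<lambda>\<omega>. M * (t - s) * indicator ?E \<omega> - indicator ?D \<omega>)"
      using DE by (intro Bochner_Integration.integrable_diff integrable_mult_right) (auto simp: emeasure_eq_measure)
    fix \<omega> assume \<omega>: "\<omega> \<in> space Q"
    have "- M * (t - s) \<le> ?I \<omega>"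
      using st by (intro set_integral_Icc_ge set_integrable_generator[OF \<omega> f])
        (auto simp: gen intro!: lam_ge control_in_U[OF control])
    then show "Y \<omega> * (f (\<omega> t) - f (\<omega> s) - ?I \<omega>) \<le> M * (t - s) * indicator ?E \<omega> - indicator ?D \<omega>"
      using \<omega> by (auto simp: Y_def f_def)
  qed
  also have "\<dots> = M * (t - s) * prob ?E - prob ?D"
    using DE by (subst Bochner_Integration.integral_diff) (auto simp: emeasure_eq_measure)
  finally show ?thesis by simp
qed

lemma prob_jump_le:
  assumes st: "0 \<le> s" "s \<le> t"
  shows "prob {\<omega> \<in> space Q. \<omega> t \<noteq> \<omega> s} \<le> M * (t - s)"
proof -
  let ?D = "\<lambda>j. {\<omega> \<in> space Q. \<omega> s = j \<and> \<omega> t \<noteq> j}" and ?E = "\<lambda>j. {\<omega> \<in> space Q. \<omega> s = j}"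
  have t: "0 \<le> t" using st by simp
  note [measurable] = measurable_state[OF st(1)] measurable_state[OF t]
  have DE: "?D j \<in> events" "?E j \<in> events" for j by measurable
  have "(\<lambda>j. prob (?D j)) sums prob (\<Union>j. ?D j)"
    using DE by (intro finite_measure_UNION) (auto simp: disjoint_family_on_def)
  moreover have "(\<lambda>j. prob (?E j)) sums prob (\<Union>j. ?E j)"
    using DE by (intro finite_measure_UNION) (auto simp: disjoint_family_on_def)
  then have "(\<lambda>j. M * (t - s) * prob (?E j)) sums (M * (t - s) * prob (\<Union>j. ?E j))"
    by (rule sums_mult)
  ultimately have "prob (\<Union>j. ?D j) \<le> M * (t - s) * prob (\<Union>j. ?E j)"
    by (intro sums_le[OF prob_leave_le[OF st]])
  moreover have "(\<Union>j. ?D j) = {\<omega> \<in> space Q. \<omega> t \<noteq> \<omega> s}" by auto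
  moreover have "(\<Union>j. ?E j) = space Q" by auto
  ultimately show ?thesis by (simp add: prob_space)
qed

text \<open>By Fubini the expectation of \<open>J\<close> is the time integral of the probabilities
  of differing from the state at time \<open>s\<close>, each at most \<open>M * (t - s)\<close>;
  integration over the interval gives the second factor \<open>t - s\<close>.\<close>

lemma occupation_off_start:
  assumes st: "0 \<le> s" "s \<le> t"
  defines "J \<equiv> \<lambda>\<omega>. LINT r:{s..t}|lborel. of_bool (\<omega> r \<noteq> \<omega> s)"
  shows "integrable Q J" "(\<integral>\<omega>. J \<omega> \<partial>Q) \<le> M * (t - s)\<^sup>2"
    and "\<And>\<omega>. \<omega> \<in> space Q \<Longrightarrow> set_integrable lborel {s..t} (\<lambda>r. of_bool (\<omega> r \<noteq> \<omega> s) :: real)"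
proof -
  interpret L: pair_sigma_finite Q lborel ..
  let ?H = "\<lambda>\<omega> r. indicator {s..t} r * of_bool (\<omega> r \<noteq> \<omega> s) :: real"
  have J: "J = (\<lambda>\<omega>. \<integral>r. ?H \<omega> r \<partial>lborel)"
    by (simp add: J_def set_lebesgue_integral_def)
  have t: "0 \<le> t" using st by simp
  define a b where "a p = fst p s" and "b p = fst p (min t (max 0 (snd p)))"
    for p :: "(real \<Rightarrow> nat) \<times> real"
  have a: "a \<in> Q \<Otimes>\<^sub>M borel \<rightarrow>\<^sub>M count_space UNIV"
    unfolding a_def by (rule measurable_compose[OF measurable_fst measurable_state[OF st(1)]])
  have b: "b \<in> Q \<Otimes>\<^sub>M borel \<rightarrow>\<^sub>M count_space UNIV"
    unfolding b_def using path_cadlag by (intro measurable_cadlag_jointly t measurable_state) auto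
  have "(\<lambda>p. of_bool (b p \<noteq> a p) :: real) \<in> borel_measurable (Q \<Otimes>\<^sub>M borel)"
    by (rule measurable_compose_countable[where f = "\<lambda>k p. of_bool (b p \<noteq> k)", OF measurable_compose[OF b] a])
      simp
  then have "(\<lambda>p. indicator {s..t} (snd p) * of_bool (b p \<noteq> a p) :: real)
      \<in> borel_measurable (Q \<Otimes>\<^sub>M borel)"
    by (intro borel_measurable_times measurable_compose[OF measurable_snd borel_measurable_indicator]) auto
  moreover have "(\<lambda>p. indicator {s..t} (snd p) * of_bool (b p \<noteq> a p) :: real) = case_prod ?H"
    using st by (auto simp: fun_eq_iff indicator_def a_def b_def)
  ultimately have Hm: "case_prod ?H \<in> borel_measurable (Q \<Otimes>\<^sub>M lborel)"
    by simp
  have Hint: "integrable (Q \<Otimes>\<^sub>M lborel) (case_prod ?H)"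
  proof (rule integrableI_bounded_set[where A = "space Q \<times> {s..t}" and B = 1])
    show "emeasure (Q \<Otimes>\<^sub>M lborel) (space Q \<times> {s..t}) < \<infinity>"
      by (simp add: lborel.emeasure_pair_measure_Times emeasure_space_1 st)
    show "AE p in Q \<Otimes>\<^sub>M lborel. p \<in> space Q \<times> {s..t} \<longrightarrow> norm (case_prod ?H p) \<le> 1"
      by (auto simp: indicator_def)
    show "AE p in Q \<Otimes>\<^sub>M lborel. p \<notin> space Q \<times> {s..t} \<longrightarrow> case_prod ?H p = 0"
      by (intro AE_I2) (auto simp: indicator_def space_pair_measure)
  qed (use Hm in auto)
  show "integrable Q J"
    unfolding J by (rule L.integrable_fst[OF Hint])
  have "(\<integral>\<omega>. J \<omega> \<partial>Q) = (\<integral>r. (\<integral>\<omega>. ?H \<omega> r \<partial>Q) \<partial>lborel)"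
    unfolding J by (rule L.Fubini_integral[OF Hint, symmetric])
  also have "\<dots> \<le> (\<integral>r. indicator {s..t} r * (M * (t - s)) \<partial>lborel)"
  proof (rule integral_mono)
    show "integrable lborel (\<lambda>r. \<integral>\<omega>. ?H \<omega> r \<partial>Q)"
      by (rule L.integrable_snd[OF Hint])
    show "integrable lborel (\<lambda>r. indicator {s..t} r * (M * (t - s)))"
      by (intro integrable_mult_left integrable_real_indicator) (auto simp: emeasure_lborel_Icc_eq)
    fix r
    show "(\<integral>\<omega>. ?H \<omega> r \<partial>Q) \<le> indicator {s..t} r * (M * (t - s))"
    proof (cases "r \<in> {s..t}")
      case True
      have "(\<integral>\<omega>. ?H \<omega> r \<partial>Q) = (\<integral>\<omega>. indicator {\<omega> \<in> space Q. \<omega> r \<noteq> \<omega> s} \<omega> \<partial>Q)"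
        using True by (intro Bochner_Integration.integral_cong) (auto simp: indicator_def)
      also have "\<dots> = prob {\<omega> \<in> space Q. \<omega> r \<noteq> \<omega> s}"
        by (simp add: Int_absorb2 Collect_restrict)
      also have "\<dots> \<le> M * (r - s)" using True st by (intro prob_jump_le) auto
      also have "\<dots> \<le> M * (t - s)" using True M_nonneg by (intro mult_left_mono) auto
      finally show ?thesis using True by simp
    qed simp
  qed
  also have "\<dots> = M * (t - s)\<^sup>2"
    using st by (simp add: power2_eq_square)
  finally show "(\<integral>\<omega>. J \<omega> \<partial>Q) \<le> M * (t - s)\<^sup>2" .
  show "set_integrable lborel {s..t} (\<lambda>r. of_bool (\<omega> r \<noteq> \<omega> s) :: real)" if "\<omega> \<in> space Q" for \<omega>
    by (rule set_integrable_path[where g = "\<lambda>k r. of_bool (k \<noteq> \<omega> s)" and b = 1])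
      (use path_cadlag[OF that] st in auto)
qed

end

section \<open>Monotonicity of the expected value\<close>

text \<open>With \<open>Suc n\<close> equal steps the errors add up to
  \<open>K * (b - a)\<^sup>2 / real (Suc n)\<close>, which vanishes in the limit.\<close>

lemma quadratic_increments_mono:
  fixes f :: "real \<Rightarrow> real"
  assumes step: "\<And>s t. a \<le> s \<Longrightarrow> s \<le> t \<Longrightarrow> t \<le> b \<Longrightarrow> f s - K * (t - s)\<^sup>2 \<le> f t" and "a \<le> b"
  shows "f a \<le> f b"
proof -
  have bound: "f a \<le> f b + K * (b - a)\<^sup>2 / real (Suc n)" for n
  proof -
    define \<delta> where "\<delta> = (b - a) / real (Suc n)"
    have \<delta>: "0 \<le> \<delta>" using \<open>a \<le> b\<close> by (simp add: \<delta>_def)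
    have "k \<le> Suc n \<Longrightarrow> f a - real k * (K * \<delta>\<^sup>2) \<le> f (a + real k * \<delta>)" for k
    proof (induction k)
      case (Suc k)
      have "real (Suc k) * \<delta> \<le> real (Suc n) * \<delta>"
        using Suc.prems \<delta> by (intro mult_right_mono) auto
      also have "\<dots> = b - a" by (simp add: \<delta>_def)
      finally have "f (a + real k * \<delta>) - K * \<delta>\<^sup>2 \<le> f (a + real (Suc k) * \<delta>)"
        using step[of "a + real k * \<delta>" "a + real (Suc k) * \<delta>"] \<delta> by (simp add: algebra_simps)
      with Suc show ?case by (simp add: algebra_simps)
    qed simp
    from this[of "Suc n"] have "f a - real (Suc n) * (K * \<delta>\<^sup>2) \<le> f b"
      by (simp add: \<delta>_def)
    moreover have "real (Suc n) * (K * \<delta>\<^sup>2) = K * (b - a)\<^sup>2 / real (Suc n)"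
      by (simp add: \<delta>_def power2_eq_square del: of_nat_Suc)
    ultimately show ?thesis by linarith
  qed
  have "(\<lambda>n. f b + K * (b - a)\<^sup>2 * (1 / real (Suc n))) \<longlonglongrightarrow> f b + K * (b - a)\<^sup>2 * 0"
    by (intro tendsto_intros LIMSEQ_Suc[OF lim_1_over_n])
  then show ?thesis
    using bound by (intro LIMSEQ_le_const[of _ "f b"]) auto
qed

text \<open>The inequality \<open>exp a - 1 \<le> a * exp a\<close> is used twice: the left side is
  at most \<open>a * (exp a - 1)\<close>, and this is at most
  \<open>a * (a * exp a)\<close>.\<close>

lemma exp_minus_linear_le:
  fixes a :: real
  assumes "0 \<le> a"
  shows "exp a - 1 - a \<le> a\<^sup>2 * exp a"
proof -
  have "exp a - 1 \<le> a * exp a"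
    using exp_ge_add_one_self[of "- a"] by (simp add: exp_minus field_simps)
  moreover from this have "a * (exp a - 1) \<le> a * (a * exp a)"
    using assms by (rule mult_left_mono)
  ultimately show ?thesis
    unfolding power2_eq_square mult.assoc right_diff_distrib by linarith
qed

text \<open>
  The estimate for a path that moves from state \<open>x\<close> at time \<open>s\<close> to state \<open>y\<close> at time
  \<open>t = s + h\<close>: \<open>Vty\<close> is the value at time \<open>t\<close> in state \<open>y\<close>, etc., \<open>a\<close> is the accumulated cost,
  \<open>I\<close> the integral of the generator applied to the value at time \<open>s\<close>, \<open>J\<close> the time spent away
  from \<open>x\<close>, and \<open>p\<close> the indicator of \<open>y \<noteq> x\<close>.
\<close>

lemma one_step_algebra:
  fixes a :: real
  assumes a: "0 \<le> a" "a \<le> \<kappa> * h" and E: "exp a \<le> E" and h: "0 \<le> h"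
    and G: "Vsx - Vtx \<le> G" "\<bar>G\<bar> \<le> K3 * h"
    and I: "G - K1 * J - K2 * h\<^sup>2 \<le> a * Vsx + I"
    and lip: "\<bar>Vty - Vsy\<bar> \<le> L * h" "\<bar>Vtx - Vsx\<bar> \<le> L * h"
    and B: "\<bar>Vty\<bar> \<le> B" "\<bar>Vsx\<bar> \<le> B"
    and p: "p = 0 \<and> Vty = Vtx \<and> Vsy = Vsx \<or> p = 1"
  shows "(Vsy - Vsx - I) - (K1 * J + (K2 + \<kappa> * L + B * \<kappa>\<^sup>2 * E) * h\<^sup>2 + (K3 + L + 2 * \<kappa> * B) * h * p)
    \<le> exp a * Vty - Vsx"
proof -
  have Lh: "0 \<le> L * h" and Bn: "0 \<le> B" and kh: "0 \<le> \<kappa> * h"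
    using lip B a by linarith+
  have "B * (exp a - 1 - a) \<le> B * ((\<kappa> * h)\<^sup>2 * E)"
    using exp_minus_linear_le[OF a(1)] a E
    by (intro mult_left_mono Bn order_trans[OF exp_minus_linear_le[OF a(1)]] mult_mono power_mono) auto
  moreover have "- (B * (exp a - 1 - a)) \<le> (exp a - 1 - a) * Vty"
  proof -
    have "0 \<le> exp a - 1 - a" using exp_ge_add_one_self[of a] by linarith
    then have "(exp a - 1 - a) * (- B) \<le> (exp a - 1 - a) * Vty"
      using B by (intro mult_left_mono) auto
    then show ?thesis by (simp add: mult.commute)
  qed
  ultimately have 1: "(1 + a) * Vty - B * \<kappa>\<^sup>2 * E * h\<^sup>2 \<le> exp a * Vty"
    by (simp add: algebra_simps power_mult_distrib)
  \<comment> \<open>Without a jump, \<open>Vty - Vsy\<close> equals \<open>Vtx - Vsx\<close>, which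
    \<open>G\<close> compensates, and only a product of two first-order terms remains. With a jump
    the three terms are merely of order \<open>h\<close>; this suffices because \<open>p\<close>
    will have expectation of order \<open>h\<close>.\<close>
  have 2: "0 \<le> a * (Vty - Vsx) + (Vty - Vsy) + G + \<kappa> * L * h\<^sup>2 + (K3 + L + 2 * \<kappa> * B) * h * p"
  proof (cases "p = 0")
    case True
    then have y: "Vty = Vtx" "Vsy = Vsx" using p by auto
    have "\<bar>a * (Vty - Vsx)\<bar> \<le> (\<kappa> * h) * (L * h)"
      unfolding abs_mult using a lip y kh by (intro mult_mono) auto
    then have "0 \<le> a * (Vty - Vsx) + \<kappa> * L * h\<^sup>2"
      by (simp add: power2_eq_square algebra_simps abs_le_iff)
    then show ?thesis using G y True by simp
  next
    case False
    then have p1: "p = 1" using p by auto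
    have "\<bar>a * (Vty - Vsx)\<bar> \<le> (\<kappa> * h) * (2 * B)"
      unfolding abs_mult using a B kh by (intro mult_mono) auto
    moreover have "0 \<le> \<kappa> * L * h\<^sup>2"
      using mult_nonneg_nonneg[OF kh Lh] by (simp add: power2_eq_square algebra_simps)
    ultimately show ?thesis
      using G lip by (simp add: p1 abs_le_iff algebra_simps)
  qed
  \<comment> \<open>The underlying identity is \<open>(1 + a) * Vty - Vsx = (Vsy - Vsx - I) + (a *
    (Vty - Vsx) + (Vty - Vsy) + G) + (a * Vsx + I - G)\<close>, whose last two brackets are bounded
    by \<open>2\<close> and \<open>I\<close>.\<close>
  show ?thesis using 1 2 I by (simp add: algebra_simps)
qed

lemma borel_measurable_lipschitz:
  fixes f :: "real \<Rightarrow> real"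
  assumes "\<And>s t. 0 \<le> s \<Longrightarrow> s \<le> t \<Longrightarrow> \<bar>f t - f s\<bar> \<le> L * (t - s)"
  shows "f \<in> borel_measurable (restrict_space borel {0..})"
proof -
  have L: "0 \<le> L" using assms[of 0 1] by auto
  have "L-lipschitz_on {0..} f"
  proof (rule lipschitz_onI[OF _ L])
    fix x y :: real assume "x \<in> {0..}" "y \<in> {0..}"
    then show "dist (f x) (f y) \<le> L * dist x y"
      using assms[of x y] assms[of y x] by (cases "x \<le> y") (auto simp: dist_real_def abs_minus_commute)
  qed
  then show ?thesis
    by (intro borel_measurable_continuous_on_restrict lipschitz_on_continuous_on)
qed

section \<open>The expected value over a short time step\<close>

context controlled_law
begin

text \<open>Only two-sided bounds and a Lipschitz condition are imposed on \<open>V\<close>, so that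
  the estimates can be instantiated both with the candidate value and with its negative.\<close>

context
  fixes q :: "nat \<Rightarrow> real \<Rightarrow> real" and V :: "real \<Rightarrow> nat \<Rightarrow> real" and \<kappa> B L :: real
  assumes q_meas: "\<And>k. q k \<in> borel_measurable (restrict_space borel {0..})"
    and q_bounds: "\<And>k r. 0 \<le> r \<Longrightarrow> 0 \<le> q k r" "\<And>k r. 0 \<le> r \<Longrightarrow> q k r \<le> \<kappa>"
    and V_bound: "\<And>k r. 0 \<le> r \<Longrightarrow> \<bar>V r k\<bar> \<le> B"
    and V_lipschitz: "\<And>k s t. 0 \<le> s \<Longrightarrow> s \<le> t \<Longrightarrow> \<bar>V t k - V s k\<bar> \<le> L * (t - s)"
begin

definition acc :: "real \<Rightarrow> (real \<Rightarrow> nat) \<Rightarrow> real" where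
  "acc t \<omega> = (LINT r:{0..t}|lborel. q (\<omega> r) r)"

lemma V_measurable: "(\<lambda>r. V r k) \<in> borel_measurable (restrict_space borel {0..})"
  by (rule borel_measurable_lipschitz[OF V_lipschitz])

lemma set_integrable_q:
  assumes "\<omega> \<in> cadlag" "0 \<le> s"
  shows "set_integrable lborel {s..t} (\<lambda>r. q (\<omega> r) r)"
  using q_bounds by (intro set_integrable_path[OF assms q_meas, where b = \<kappa>]) auto

lemma constants_nonneg: "0 \<le> \<kappa>" "0 \<le> B" "0 \<le> L"
proof -
  show "0 \<le> \<kappa>" using q_bounds[OF order_refl, of 0] by linarith
  show "0 \<le> B" using V_bound[OF order_refl, of 0] by linarith
  have "\<bar>V 1 0 - V 0 0\<bar> \<le> L * (1 - 0)" by (rule V_lipschitz) auto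
  then show "0 \<le> L" by simp
qed

text \<open>Freezing the state amounts to integrating along a constant path, which is
  cadlag.\<close>

lemma frozen_set_integrable:
  assumes "0 \<le> s"
  shows "set_integrable lborel {s..t} (\<lambda>r. q k r * V r k + generator lam u r (V r) k)"
proof (rule set_integrable_path[where \<omega> = "\<lambda>_. k" and b = "\<kappa> * B + 2 * M * B"
      and g = "\<lambda>_ r. q k r * V r k + generator lam u r (V r) k"])
  show "(\<lambda>_. k) \<in> cadlag" by (auto simp: cadlag_def)
  show "(\<lambda>r. q k r * V r k + generator lam u r (V r) k) \<in> borel_measurable (restrict_space borel {0..})"
    by (intro borel_measurable_add borel_measurable_times q_meas V_measurable borel_measurable_generator)
  show "\<bar>q k r * V r k + generator lam u r (V r) k\<bar> \<le> \<kappa> * B + 2 * M * B" if "0 \<le> r" for r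
  proof -
    have "\<bar>q k r * V r k\<bar> \<le> \<kappa> * B"
      unfolding abs_mult using q_bounds[OF that] V_bound[OF that] constants_nonneg
      by (intro mult_mono) auto
    then show ?thesis
      using generator_bound[of "V r" B r k, OF V_bound[OF that] that] by linarith
  qed
qed (rule assms)

lemma acc_bounds:
  assumes "\<omega> \<in> cadlag" "0 \<le> s" "s \<le> t"
  shows "0 \<le> (LINT r:{s..t}|lborel. q (\<omega> r) r)" "(LINT r:{s..t}|lborel. q (\<omega> r) r) \<le> \<kappa> * (t - s)"
proof -
  note i = set_integrable_q[OF assms(1,2)]
  show "0 \<le> (LINT r:{s..t}|lborel. q (\<omega> r) r)"
    using set_integral_Icc_ge[OF assms(3) i, of 0] q_bounds assms(2) by auto
  have "\<bar>LINT r:{s..t}|lborel. q (\<omega> r) r\<bar> \<le> \<kappa> * (t - s)"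
    using q_bounds assms(2) by (intro set_integral_Icc_abs_le[OF assms(3) i]) auto
  then show "(LINT r:{s..t}|lborel. q (\<omega> r) r) \<le> \<kappa> * (t - s)" by linarith
qed

lemma acc_measurable:
  assumes "0 \<le> t"
  shows "acc t \<in> borel_measurable (path_filtration t)"
  unfolding acc_def
  by (rule borel_measurable_path_integral[OF order_refl assms _ measurable_path_filtration_component q_meas])
    (auto simp: space_path_space)

lemma integrable_exp_acc:
  assumes "0 \<le> t"
  shows "integrable Q (\<lambda>\<omega>. exp (acc t \<omega>) * V t (\<omega> t))"
proof (rule integrable_const_bound)
  have "\<bar>exp (acc t \<omega>) * V t (\<omega> t)\<bar> \<le> exp (\<kappa> * t) * B" if "\<omega> \<in> space Q" for \<omega>
    unfolding abs_mult acc_def using V_bound[OF assms] acc_bounds(2)[OF path_cadlag[OF that] order_refl assms]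
    by (intro mult_mono) auto
  then show "AE \<omega> in Q. norm (exp (acc t \<omega>) * V t (\<omega> t)) \<le> exp (\<kappa> * t) * B"
    by simp
  show "(\<lambda>\<omega>. exp (acc t \<omega>) * V t (\<omega> t)) \<in> borel_measurable Q"
    by (intro borel_measurable_times borel_measurable_exp borel_measurable_state[OF assms]
        measurable_compose[OF borel_measurable_from_filtration[OF assms acc_measurable[OF assms]] borel_measurable_exp])
qed

text \<open>The integrands are compared at each time \<open>r\<close>. While the path is still in
  its state at time \<open>s\<close>, only \<open>V r\<close> and \<open>V s\<close> differ, by at
  most \<open>L * (t - s)\<close>; this costs \<open>\<kappa> * L + 2 * M * L\<close> times
  \<open>t - s\<close> and, integrated, a square. Elsewhere nothing cancels: each of the two
  integrands is at most \<open>\<kappa> * B + 2 * M * B\<close> in modulus, and their sum is the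
  constant in front of the time spent away.\<close>

lemma frozen_comparison:
  assumes \<omega>: "\<omega> \<in> space Q" and st: "0 \<le> s" "s \<le> t"
  shows "(LINT r:{s..t}|lborel. q (\<omega> s) r * V r (\<omega> s) + generator lam u r (V r) (\<omega> s))
      - (2 * \<kappa> * B + 4 * M * B) * (LINT r:{s..t}|lborel. of_bool (\<omega> r \<noteq> \<omega> s))
      - (\<kappa> * L + 2 * M * L) * (t - s)\<^sup>2
    \<le> (LINT r:{s..t}|lborel. q (\<omega> r) r) * V s (\<omega> s) + (LINT r:{s..t}|lborel. generator lam u r (V s) (\<omega> r))"
    (is "?G - ?K1 * ?J - ?K2 * _ \<le> _")
proof -
  let ?h = "t - s" and ?x = "\<omega> s"
  note ints = frozen_set_integrable[OF st(1), of t ?x]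
    occupation_off_start(3)[OF st \<omega>]
    set_integrable_q[OF path_cadlag[OF \<omega>] st(1), of t]
    set_integrable_generator[of \<omega> "V s" B s t, OF \<omega> V_bound[OF st(1)] st(1)]
  define e where "e = ?K2 * ?h"
  have const: "set_integrable lborel {s..t} (\<lambda>r. e)"
    unfolding set_integrable_def by (intro integrable_scaleR_left integrable_real_indicator)
      (auto simp: emeasure_lborel_Icc_eq)
  let ?lhs = "\<lambda>r. q ?x r * V r ?x + generator lam u r (V r) ?x - ?K1 * of_bool (\<omega> r \<noteq> ?x) - e"
  let ?rhs = "\<lambda>r. q (\<omega> r) r * V s ?x + generator lam u r (V s) (\<omega> r)"
  have "(LINT r:{s..t}|lborel. ?lhs r) \<le> (LINT r:{s..t}|lborel. ?rhs r)"
  proof (rule set_integral_mono)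
    show "set_integrable lborel {s..t} ?lhs"
      using ints const by (intro set_integral_diff(1) set_integrable_mult_right) auto
    show "set_integrable lborel {s..t} ?rhs"
      using ints by (intro set_integral_add(1) set_integrable_mult_left) auto
    fix r assume "r \<in> {s..t}"
    then have r: "s \<le> r" "0 \<le> r" "r \<le> t" using st by auto
    have "\<bar>q k r * V r ?x\<bar> \<le> \<kappa> * B" "\<bar>q k r * V s ?x\<bar> \<le> \<kappa> * B" for k
      unfolding abs_mult using q_bounds[OF r(2)] V_bound[OF r(2)] V_bound[OF st(1)] constants_nonneg
      by (intro mult_mono; simp)+
    note qV = this[THEN abs_le_D1] this[THEN abs_le_D2]
    have gV: "\<bar>generator lam u r (V r) k\<bar> \<le> 2 * M * B" "\<bar>generator lam u r (V s) k\<bar> \<le> 2 * M * B" for k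
      using generator_bound V_bound r st by auto
    have Lh: "\<bar>V r k - V s k\<bar> \<le> L * ?h" for k
      using V_lipschitz[OF st(1) r(1), of k] mult_left_mono[of "r - s" ?h L] r constants_nonneg by linarith
    show "?lhs r \<le> ?rhs r"
    proof (cases "\<omega> r = ?x")
      case True
      have "\<bar>q ?x r * (V r ?x - V s ?x)\<bar> \<le> \<kappa> * (L * ?h)"
        unfolding abs_mult using q_bounds[OF r(2)] Lh constants_nonneg by (intro mult_mono) auto
      moreover have "\<bar>generator lam u r (V r) ?x - generator lam u r (V s) ?x\<bar> \<le> 2 * M * (L * ?h)"
        unfolding generator_def
        by (rule rate_sum_diff_bounded[where f = "V r" and g = "V s" and b = B])
            (intro control_in_U[OF control r(2)] V_bound r st Lh)+
      ultimately show ?thesis using True by (simp add: e_def algebra_simps abs_le_iff)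
    next
      case False
      moreover have "0 \<le> e"
        unfolding e_def using constants_nonneg M_nonneg st by (intro mult_nonneg_nonneg add_nonneg_nonneg) auto
      ultimately show ?thesis
        using qV[of ?x] qV[of "\<omega> r"] gV(1)[of ?x] gV(2)[of "\<omega> r"] by (simp add: abs_le_iff)
    qed
  qed
  also have "(LINT r:{s..t}|lborel. ?rhs r) =
      (LINT r:{s..t}|lborel. q (\<omega> r) r) * V s ?x + (LINT r:{s..t}|lborel. generator lam u r (V s) (\<omega> r))"
    using ints by (subst set_integral_add(2)) auto
  also have "(LINT r:{s..t}|lborel. ?lhs r) = ?G - ?K1 * ?J - (LINT r:{s..t}|lborel. e)"
  proof -
    have J: "set_integrable lborel {s..t} (\<lambda>r. ?K1 * of_bool (\<omega> r \<noteq> ?x))"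
      using ints(2) by (intro set_integrable_mult_right) auto
    show ?thesis
      unfolding set_integral_diff(2)[OF set_integral_diff(1)[OF ints(1) J] const]
        set_integral_diff(2)[OF ints(1) J] by simp
  qed
  also have "(LINT r:{s..t}|lborel. e) = ?K2 * ?h\<^sup>2"
    using st by (simp add: set_lebesgue_integral_def power2_eq_square e_def)
  finally show ?thesis .
qed

text \<open>This is \<open>dV/dt + q * V + generator V \<ge> 0\<close>, integrated over
  \<open>[s, t]\<close> at a frozen state; formally it makes the exponentially weighted
  \<open>V\<close> a submartingale. In the application it is obtained from the equation for
  \<open>w\<close>.\<close>

context
  assumes V_super: "\<And>k s t. 0 \<le> s \<Longrightarrow> s \<le> t \<Longrightarrow>
      V s k - V t k \<le> (LINT r:{s..t}|lborel. q k r * V r k + generator lam u r (V r) k)"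
begin

text \<open>The constant depends on \<open>T\<close> but not on \<open>s\<close> and
  \<open>t\<close>, as summation over a partition requires. Both \<open>exp (acc s \<omega>)\<close>
  and the exponential of the cost within the step are at most \<open>exp (\<kappa> * T)\<close>. The
  two factors \<open>M\<close> come from the expected time away from the starting state and from the
  probability of having left it at time \<open>t\<close>.\<close>

lemma expected_value_step:
  assumes st: "0 \<le> s" "s \<le> t" "t \<le> T"
  shows "(\<integral>\<omega>. exp (acc s \<omega>) * V s (\<omega> s) \<partial>Q) - exp (\<kappa> * T) * ((2 * \<kappa> * B + 4 * M * B) * M +
      (\<kappa> * L + 2 * M * L + \<kappa> * L + B * \<kappa>\<^sup>2 * exp (\<kappa> * T)) + (\<kappa> * B + 2 * M * B + L + 2 * \<kappa> * B) * M) * (t - s)\<^sup>2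
    \<le> (\<integral>\<omega>. exp (acc t \<omega>) * V t (\<omega> t) \<partial>Q)"
proof -
  define h where "h = t - s"
  define E where "E = exp (\<kappa> * T)"
  define K1 where "K1 = 2 * \<kappa> * B + 4 * M * B"
  define K2 where "K2 = \<kappa> * L + 2 * M * L"
  define K3 where "K3 = \<kappa> * B + 2 * M * B"
  have h: "0 \<le> h" "0 \<le> t" using st by (auto simp: h_def)
  note nonneg = constants_nonneg M_nonneg
  have Kn: "0 \<le> K1" "0 \<le> K2" "0 \<le> K3" "0 \<le> E"
    using nonneg by (auto simp: K1_def K2_def K3_def E_def)
  define J where "J \<omega> = (LINT r:{s..t}|lborel. of_bool (\<omega> r \<noteq> \<omega> s) :: real)" for \<omega> :: "real \<Rightarrow> nat"
  define S where "S = {\<omega> \<in> space Q. \<omega> t \<noteq> \<omega> s}"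
  define R where "R \<omega> = K1 * J \<omega> + (K2 + \<kappa> * L + B * \<kappa>\<^sup>2 * E) * h\<^sup>2 + (K3 + L + 2 * \<kappa> * B) * h * indicator S \<omega>" for \<omega>
  define N where "N \<omega> = V s (\<omega> t) - V s (\<omega> s) - (LINT r:{s..t}|lborel. generator lam u r (V s) (\<omega> r))" for \<omega>
  have J: "integrable Q J" "(\<integral>\<omega>. J \<omega> \<partial>Q) \<le> M * h\<^sup>2"
    unfolding J_def h_def using occupation_off_start[OF st(1,2)] by auto
  have S: "S \<in> events"
    unfolding S_def using measurable_state[OF st(1)] measurable_state[OF h(2)] by measurable
  have probS: "prob S \<le> M * h"
    unfolding S_def h_def by (rule prob_jump_le[OF st(1,2)])
  have acc_le: "0 \<le> acc s \<omega>" "exp (acc s \<omega>) \<le> E" if "\<omega> \<in> space Q" for \<omega>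
  proof -
    have "\<kappa> * s \<le> \<kappa> * T" using st nonneg by (intro mult_left_mono) auto
    then show "0 \<le> acc s \<omega>" "exp (acc s \<omega>) \<le> E"
      using acc_bounds[OF path_cadlag[OF that] order_refl st(1)] by (auto simp: acc_def E_def)
  qed
  have N: "integrable Q (\<lambda>\<omega>. exp (acc s \<omega>) * N \<omega>)" "(\<integral>\<omega>. exp (acc s \<omega>) * N \<omega> \<partial>Q) = 0"
    unfolding N_def
    by (rule martingale_increment[where f = "V s" and b = B and Y = "\<lambda>\<omega>. exp (acc s \<omega>)" and y = E];
        use acc_le(2) acc_measurable[OF st(1)] V_bound[OF st(1)] st in auto)+
  have Rint: "integrable Q R"
    unfolding R_def using J(1) S by (intro Bochner_Integration.integrable_add integrable_mult_right)
      (auto simp: emeasure_eq_measure)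
  have "- (E * (K1 * M + (K2 + \<kappa> * L + B * \<kappa>\<^sup>2 * E) + (K3 + L + 2 * \<kappa> * B) * M) * h\<^sup>2)
      \<le> - (E * (\<integral>\<omega>. R \<omega> \<partial>Q))"
  proof -
    have "(\<integral>\<omega>. R \<omega> \<partial>Q) = K1 * (\<integral>\<omega>. J \<omega> \<partial>Q) + (K2 + \<kappa> * L + B * \<kappa>\<^sup>2 * E) * h\<^sup>2 + (K3 + L + 2 * \<kappa> * B) * h * prob S"
      unfolding R_def using J(1) S by (simp add: emeasure_eq_measure prob_space)
    also have "\<dots> \<le> K1 * (M * h\<^sup>2) + (K2 + \<kappa> * L + B * \<kappa>\<^sup>2 * E) * h\<^sup>2 + (K3 + L + 2 * \<kappa> * B) * h * (M * h)"
      using J(2) probS Kn nonneg h by (intro add_mono mult_left_mono order_refl) auto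
    also have "\<dots> = (K1 * M + (K2 + \<kappa> * L + B * \<kappa>\<^sup>2 * E) + (K3 + L + 2 * \<kappa> * B) * M) * h\<^sup>2"
      by (simp add: power2_eq_square algebra_simps)
    finally show ?thesis
      using Kn(4) by (simp add: mult.assoc mult_left_mono)
  qed
  also have "\<dots> = (\<integral>\<omega>. exp (acc s \<omega>) * N \<omega> - E * R \<omega> \<partial>Q)"
    using N Rint by simp
  \<comment> \<open>Pathwise, the increment is \<open>exp (acc s \<omega>)\<close> times
    \<open>exp a * V t (\<omega> t) - V s (\<omega> s)\<close>, and the second factor is at least
    \<open>N \<omega> - R \<omega>\<close> by \<open>one_step_algebra\<close>.\<close>
  also have "\<dots> \<le> (\<integral>\<omega>. exp (acc t \<omega>) * V t (\<omega> t) - exp (acc s \<omega>) * V s (\<omega> s) \<partial>Q)"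
  proof (rule integral_mono)
    show "integrable Q (\<lambda>\<omega>. exp (acc s \<omega>) * N \<omega> - E * R \<omega>)"
      using N(1) Rint by simp
    show "integrable Q (\<lambda>\<omega>. exp (acc t \<omega>) * V t (\<omega> t) - exp (acc s \<omega>) * V s (\<omega> s))"
      by (intro Bochner_Integration.integrable_diff integrable_exp_acc h st)
    fix \<omega> assume \<omega>: "\<omega> \<in> space Q"
    note cad = path_cadlag[OF \<omega>]
    define a where "a = (LINT r:{s..t}|lborel. q (\<omega> r) r)"
    have acc_t: "acc t \<omega> = acc s \<omega> + a"
      unfolding acc_def a_def by (intro set_integral_Icc_split set_integrable_q cad st order_refl)
    have a: "0 \<le> a" "a \<le> \<kappa> * h"
      using acc_bounds[OF cad st(1,2)] by (auto simp: a_def h_def)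
    have "\<kappa> * h \<le> \<kappa> * T" using st nonneg by (intro mult_left_mono) (auto simp: h_def)
    then have aE: "exp a \<le> E" using a by (simp add: E_def)
    let ?G = "LINT r:{s..t}|lborel. q (\<omega> s) r * V r (\<omega> s) + generator lam u r (V r) (\<omega> s)"
    have G: "\<bar>?G\<bar> \<le> K3 * h"
      unfolding h_def
    proof (rule set_integral_Icc_abs_le[OF st(2) frozen_set_integrable[OF st(1)]])
      fix r assume "s \<le> r" "r \<le> t"
      then have r: "0 \<le> r" using st by simp
      have "\<bar>q (\<omega> s) r * V r (\<omega> s)\<bar> \<le> \<kappa> * B"
        unfolding abs_mult using q_bounds[OF r] V_bound[OF r] nonneg by (intro mult_mono) auto
      then show "\<bar>q (\<omega> s) r * V r (\<omega> s) + generator lam u r (V r) (\<omega> s)\<bar> \<le> K3"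
        using generator_bound[of "V r" B r "\<omega> s", OF V_bound[OF r] r] unfolding K3_def by linarith
    qed
    have "N \<omega> - R \<omega> \<le> exp a * V t (\<omega> t) - V s (\<omega> s)"
      unfolding N_def R_def
    proof (rule one_step_algebra[OF a aE h(1) V_super[OF st(1,2)] G])
      show "?G - K1 * J \<omega> - K2 * h\<^sup>2 \<le> a * V s (\<omega> s) + (LINT r:{s..t}|lborel. generator lam u r (V s) (\<omega> r))"
        using frozen_comparison[OF \<omega> st(1,2)] by (simp add: K1_def K2_def J_def h_def a_def)
      show "\<bar>V t (\<omega> t) - V s (\<omega> t)\<bar> \<le> L * h" "\<bar>V t (\<omega> s) - V s (\<omega> s)\<bar> \<le> L * h"
        unfolding h_def by (intro V_lipschitz st)+
      show "\<bar>V t (\<omega> t)\<bar> \<le> B" "\<bar>V s (\<omega> s)\<bar> \<le> B"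
        by (intro V_bound h st)+
    qed (use \<omega> in \<open>auto simp: S_def indicator_def\<close>)
    then have "exp (acc s \<omega>) * (N \<omega> - R \<omega>) \<le> exp (acc s \<omega>) * (exp a * V t (\<omega> t) - V s (\<omega> s))"
      by (rule mult_left_mono) simp
    \<comment> \<open>The error \<open>R\<close> is nonnegative, so its random weight can be
      replaced by the constant \<open>E\<close>. The weight of \<open>N\<close> has to stay, since
      it is the weighted \<open>N\<close> that is known to have expectation zero.\<close>
    moreover have "exp (acc s \<omega>) * R \<omega> \<le> E * R \<omega>"
    proof (rule mult_right_mono[OF acc_le(2)[OF \<omega>]])
      have "0 \<le> J \<omega>"
        using set_integral_Icc_ge[OF st(2) occupation_off_start(3)[OF st(1,2) \<omega>], of 0] by (simp add: J_def)
      then show "0 \<le> R \<omega>"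
        unfolding R_def using Kn nonneg h by (intro add_nonneg_nonneg mult_nonneg_nonneg) auto
    qed
    ultimately show "exp (acc s \<omega>) * N \<omega> - E * R \<omega> \<le> exp (acc t \<omega>) * V t (\<omega> t) - exp (acc s \<omega>) * V s (\<omega> s)"
      by (simp add: acc_t exp_add algebra_simps)
  qed
  also have "\<dots> = (\<integral>\<omega>. exp (acc t \<omega>) * V t (\<omega> t) \<partial>Q) - (\<integral>\<omega>. exp (acc s \<omega>) * V s (\<omega> s) \<partial>Q)"
    by (intro Bochner_Integration.integral_diff integrable_exp_acc h st)
  finally show ?thesis
    by (simp add: E_def K1_def K2_def K3_def h_def)
qed

lemma expected_value_mono:
  assumes "0 \<le> t"
  shows "V 0 x0 \<le> (\<integral>\<omega>. exp (LINT r:{0..t}|lborel. q (\<omega> r) r) * V t (\<omega> t) \<partial>Q)"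
proof -
  \<comment> \<open>The horizon \<open>t\<close> plays the role of \<open>T\<close>, so one
    quadratic constant serves all subintervals.\<close>
  have "(\<integral>\<omega>. exp (acc 0 \<omega>) * V 0 (\<omega> 0) \<partial>Q) \<le> (\<integral>\<omega>. exp (acc t \<omega>) * V t (\<omega> t) \<partial>Q)"
    by (rule quadratic_increments_mono[OF _ assms,
          where f = "\<lambda>t. \<integral>\<omega>. exp (acc t \<omega>) * V t (\<omega> t) \<partial>Q"]) (rule expected_value_step)
  moreover have "(\<integral>\<omega>. exp (acc 0 \<omega>) * V 0 (\<omega> 0) \<partial>Q) = (\<integral>\<omega>. V 0 x0 \<partial>Q)"
  proof (rule integral_cong_AE)
    have "acc 0 \<omega> = 0" if "\<omega> \<in> space Q" for \<omega>
      using acc_bounds[OF path_cadlag[OF that], of 0 0] by (simp add: acc_def)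
    with AE_start AE_space show "AE \<omega> in Q. exp (acc 0 \<omega>) * V 0 (\<omega> 0) = V 0 x0"
      by (auto elim!: eventually_elim2)
  qed (use integrable_exp_acc[of 0] in auto)
  ultimately show ?thesis by (simp add: acc_def prob_space)
qed

end

end

end

section \<open>The dynamic programming equation\<close>

lemma abs_cINF_diff_le:
  fixes f g :: "'a \<Rightarrow> real"
  assumes "S \<noteq> {}" "\<And>x. x \<in> S \<Longrightarrow> \<bar>f x\<bar> \<le> b" "\<And>x. x \<in> S \<Longrightarrow> \<bar>g x\<bar> \<le> b"
    and "\<And>x. x \<in> S \<Longrightarrow> \<bar>f x - g x\<bar> \<le> e"
  shows "\<bar>(INF x\<in>S. f x) - (INF x\<in>S. g x)\<bar> \<le> e"
proof -
  have bdd: "bdd_below (f ` S)" "bdd_below (g ` S)"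
    using assms(2,3) by (auto intro!: bdd_belowI[of _ "- b"] simp: abs_le_iff minus_le_iff)
  have "(INF x\<in>S. f x) - e \<le> (INF x\<in>S. g x)"
  proof (rule cINF_greatest[OF assms(1)])
    fix x assume "x \<in> S"
    then show "(INF x\<in>S. f x) - e \<le> g x"
      using cINF_lower[OF bdd(1), of x] assms(4)[of x] by linarith
  qed
  moreover have "(INF x\<in>S. g x) - e \<le> (INF x\<in>S. f x)"
  proof (rule cINF_greatest[OF assms(1)])
    fix x assume "x \<in> S"
    then show "(INF x\<in>S. g x) - e \<le> f x"
      using cINF_lower[OF bdd(2), of x] assms(4)[of x] by linarith
  qed
  ultimately show ?thesis by linarith
qed

lemma set_integrable_exp_decay:
  fixes a :: real
  assumes "0 < a"
  shows "set_integrable lborel {0..} (\<lambda>r. exp (- a * r))"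
proof -
  have "set_integrable lebesgue {0..} (\<lambda>r. exp (- a * r))"
    by (intro nonnegative_absolutely_integrable_1 integrable_on_exp_minus_to_infinity assms) simp
  then show ?thesis
    unfolding set_integrable_def by (subst (asm) integrable_completion) auto
qed

locale hjb_problem = jump_rates U d lam M
  for U :: "nat \<Rightarrow> 'u set" and d lam M +
  fixes c :: "nat \<Rightarrow> 'u \<Rightarrow> real" and w :: "real \<Rightarrow> nat \<Rightarrow> real" and \<alpha> C B :: real
  assumes cost_nonneg: "\<And>i v. v \<in> U i \<Longrightarrow> 0 \<le> c i v"
    and cost_le: "\<And>i v. v \<in> U i \<Longrightarrow> c i v \<le> C"
    and cost_cont: "\<And>i. continuous_map (Metric_space.mtopology (U i) (d i)) euclideanreal (c i)"
    and discount: "0 < \<alpha>"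
    and w_bounded: "\<And>\<theta> i. \<theta> \<in> {0<..<1} \<Longrightarrow> \<bar>w \<theta> i\<bar> \<le> B"
    and w_C1: "\<And>i. (\<lambda>\<theta>. w \<theta> i) C1_differentiable_on {0<..<1}"
    and w_hjb: "\<And>\<theta> i. \<theta> \<in> {0<..<1} \<Longrightarrow>
      \<alpha> * \<theta> * deriv (\<lambda>s. w s i) \<theta> = (INF v\<in>U i. hjb_expr lam c w \<theta> i v)"
    and w_limit: "uniform_limit UNIV w (\<lambda>i. 1) (at_right 0)"
begin

abbreviation hjb :: "real \<Rightarrow> nat \<Rightarrow> 'u \<Rightarrow> real" where
  "hjb \<equiv> hjb_expr lam c w"

text \<open>A bound on \<open>hjb\<close>, hence by the equation on
  \<open>\<alpha> * \<theta>\<close> times the derivative of \<open>w\<close>; it becomes the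
  Lipschitz constant of the value in time.\<close>

definition D :: real where "D = C * B + 2 * M * B"

lemma C_nonneg: "0 \<le> C"
proof -
  obtain v where "v \<in> U 0" using U_nonempty by blast
  then show ?thesis using cost_nonneg[of v 0] cost_le[of v 0] by linarith
qed

lemma continuous_map_hjb:
  assumes "\<theta> \<in> {0<..<1}"
  shows "continuous_map (topo i) euclideanreal (hjb \<theta> i)"
  unfolding hjb_expr_def
  by (intro continuous_map_add continuous_map_real_mult cost_cont
      continuous_map_rate_sum[OF w_bounded[OF assms]]) auto

lemma hjb_abs_le:
  assumes \<theta>: "\<theta> \<in> {0<..<1}" and v: "v \<in> U i"
  shows "\<bar>hjb \<theta> i v\<bar> \<le> D"
proof -
  have "\<theta> * c i v \<le> 1 * C"
    using \<theta> cost_nonneg[OF v] cost_le[OF v] by (intro mult_mono) auto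
  then have "\<bar>\<theta> * c i v * w \<theta> i\<bar> \<le> C * B"
    unfolding abs_mult[of "\<theta> * c i v"] using \<theta> cost_nonneg[OF v] w_bounded[OF \<theta>] C_nonneg
    by (intro mult_mono) auto
  then show ?thesis
    using rate_sum_bounded(2)[of v i "w \<theta>" B, OF v w_bounded[OF \<theta>]]
    unfolding hjb_expr_def D_def by linarith
qed

lemma hjb_INF_lower:
  assumes "\<theta> \<in> {0<..<1}" "S \<subseteq> U i" "v \<in> S"
  shows "(INF v\<in>S. hjb \<theta> i v) \<le> hjb \<theta> i v"
proof (rule cINF_lower)
  have "- D \<le> hjb \<theta> i v" if "v \<in> S" for v
    using hjb_abs_le[of \<theta> v i] assms that by auto
  then show "bdd_below (hjb \<theta> i ` S)"
    by (intro bdd_belowI[of _ "- D"]) auto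
qed (rule assms)

lemma hjb_INF_abs_le:
  assumes "\<theta> \<in> {0<..<1}"
  shows "\<bar>INF v\<in>U i. hjb \<theta> i v\<bar> \<le> D"
  using U_nonempty hjb_abs_le[OF assms] by (intro cInf_abs_ge) auto

text \<open>Closed subsets of \<open>U i\<close> are covered as well, because measurability of the
  set of minimizers is tested by intersecting it with closed sets.\<close>

lemma hjb_attains_INF:
  assumes \<theta>: "\<theta> \<in> {0<..<1}" and S: "closedin (topo i) S" "S \<noteq> {}"
  shows "\<exists>v\<in>S. hjb \<theta> i v = (INF v\<in>S. hjb \<theta> i v)"
proof -
  have "compactin (topo i) S"
    using U_compact S(1) by (rule closedin_compact_space)
  then have "compactin euclideanreal (hjb \<theta> i ` S)"
    by (rule image_compactin[OF _ continuous_map_hjb[OF \<theta>]])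
  then have "compact (hjb \<theta> i ` S)" by simp
  then obtain v where v: "v \<in> S" "\<And>v'. v' \<in> S \<Longrightarrow> hjb \<theta> i v \<le> hjb \<theta> i v'"
    using compact_attains_inf[of "hjb \<theta> i ` S"] S(2) by blast
  then have "(INF v\<in>S. hjb \<theta> i v) = hjb \<theta> i v"
    by (intro cInf_eq_minimum) auto
  with v(1) show ?thesis by metis
qed

lemma w_DERIV:
  assumes "\<theta> \<in> {0<..<1}"
  shows "((\<lambda>s. w s i) has_real_derivative deriv (\<lambda>s. w s i) \<theta>) (at \<theta>)"
  using w_C1[of i] assms by (simp add: C1_differentiable_on_eq DERIV_deriv_iff_real_differentiable)

text \<open>With \<open>x = ln \<theta>\<close> the derivative of \<open>w (exp x) i\<close> is
  \<open>\<theta>\<close> times that of \<open>w\<close>, which the equation bounds by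
  \<open>D / \<alpha>\<close>; the mean value inequality applies on the convex set
  \<open>{..<0}\<close>.\<close>

lemma w_log_lipschitz:
  assumes "a \<in> {0<..<1}" "b \<in> {0<..<1}"
  shows "\<bar>w a i - w b i\<bar> \<le> D / \<alpha> * \<bar>ln a - ln b\<bar>"
proof -
  have "norm (w (exp (ln a)) i - w (exp (ln b)) i) \<le> D / \<alpha> * norm (ln a - ln b)"
  proof (rule field_differentiable_bound[where S = "{..<0}"
        and f' = "\<lambda>x. deriv (\<lambda>s. w s i) (exp x) * exp x"])
    fix x :: real assume x: "x \<in> {..<0}"
    then have e: "exp x \<in> {0<..<1}" by simp
    show "((\<lambda>x. w (exp x) i) has_real_derivative deriv (\<lambda>s. w s i) (exp x) * exp x) (at x within {..<0})"
      by (rule has_field_derivative_at_within[OF DERIV_chain2[OF w_DERIV[OF e] DERIV_exp]])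
    have "\<alpha> * \<bar>deriv (\<lambda>s. w s i) (exp x) * exp x\<bar> = \<bar>\<alpha> * exp x * deriv (\<lambda>s. w s i) (exp x)\<bar>"
      using discount by (simp add: abs_mult)
    also have "\<dots> \<le> D"
      using hjb_INF_abs_le[OF e, of i] w_hjb[OF e, of i] by simp
    finally show "norm (deriv (\<lambda>s. w s i) (exp x) * exp x) \<le> D / \<alpha>"
      using discount by (simp add: field_simps)
  qed (use assms in auto)
  then show ?thesis using assms by simp
qed

text \<open>The change of the factor \<open>\<theta>\<close>, that of \<open>w\<close> in the cost
  term and that of \<open>w\<close> in the rate sum are estimated separately. The bound is the same
  for all actions and so passes to infima over any set of actions.\<close>

lemma hjb_diff_le:
  assumes ab: "a \<in> {0<..<1}" "b \<in> {0<..<1}" and v: "v \<in> U i"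
  shows "\<bar>hjb a i v - hjb b i v\<bar> \<le> C * B * \<bar>a - b\<bar> + (C + 2 * M) * (D / \<alpha> * \<bar>ln a - ln b\<bar>)"
proof -
  define l where "l = D / \<alpha> * \<bar>ln a - ln b\<bar>"
  have l: "\<bar>w a j - w b j\<bar> \<le> l" for j
    unfolding l_def by (rule w_log_lipschitz[OF ab])
  note c = cost_nonneg[OF v] cost_le[OF v]
  have "\<bar>(a - b) * c i v * w a i\<bar> \<le> \<bar>a - b\<bar> * C * B"
    unfolding abs_mult using c w_bounded[OF ab(1)] C_nonneg by (intro mult_mono) auto
  moreover have "\<bar>b * c i v * (w a i - w b i)\<bar> \<le> 1 * C * l"
    unfolding abs_mult[of "b * c i v"] abs_mult[of b] using c ab C_nonneg l
    by (intro mult_mono) auto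
  moreover have "\<bar>(\<Sum>j. lam i j v * w a j) - (\<Sum>j. lam i j v * w b j)\<bar> \<le> 2 * M * l"
    by (rule rate_sum_diff_bounded[where f = "w a" and g = "w b" and b = B, OF v])
      (intro w_bounded ab l)+
  moreover have "hjb a i v - hjb b i v = (a - b) * c i v * w a i + b * c i v * (w a i - w b i) +
      ((\<Sum>j. lam i j v * w a j) - (\<Sum>j. lam i j v * w b j))"
    by (simp add: hjb_expr_def algebra_simps)
  ultimately have "\<bar>hjb a i v - hjb b i v\<bar> \<le> \<bar>a - b\<bar> * C * B + 1 * C * l + 2 * M * l"
    by linarith
  then show ?thesis unfolding l_def[symmetric] by (simp add: algebra_simps)
qed

lemma continuous_on_hjb_INF:
  assumes S: "S \<subseteq> U i" "S \<noteq> {}"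
  shows "continuous_on {0<..<1} (\<lambda>\<theta>. INF v\<in>S. hjb \<theta> i v)"
  unfolding continuous_on_def
proof
  fix a :: real assume a: "a \<in> {0<..<1}"
  let ?f = "\<lambda>\<theta>. INF v\<in>S. hjb \<theta> i v"
  define e where "e b = C * B * \<bar>b - a\<bar> + (C + 2 * M) * (D / \<alpha> * \<bar>ln b - ln a\<bar>)" for b
  have "a \<noteq> 0" using a by simp
  then have "((\<lambda>b. e b) \<longlongrightarrow> C * B * \<bar>a - a\<bar> + (C + 2 * M) * (D / \<alpha> * \<bar>ln a - ln a\<bar>)) (at a within {0<..<1})"
    unfolding e_def by (intro tendsto_intros)
  then have e0: "(e \<longlongrightarrow> 0) (at a within {0<..<1})"
    unfolding diff_self abs_zero mult_zero_right add_0_right .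
  have bound: "norm (?f b - ?f a) \<le> e b" if b: "b \<in> {0<..<1}" for b
    unfolding real_norm_def
  proof (rule abs_cINF_diff_le[OF S(2), where b = D])
    fix v assume "v \<in> S"
    then have v: "v \<in> U i" using S(1) by blast
    show "\<bar>hjb b i v\<bar> \<le> D" "\<bar>hjb a i v\<bar> \<le> D" "\<bar>hjb b i v - hjb a i v\<bar> \<le> e b"
      unfolding e_def using hjb_abs_le[OF b v] hjb_abs_le[OF a v] hjb_diff_le[OF b a v] by blast+
  qed
  have "\<forall>\<^sub>F b in at a within {0<..<1}. norm (?f b - ?f a) \<le> e b"
    unfolding eventually_at_filter by (intro always_eventually allI impI bound)
  from Lim_null_comparison[OF this e0] show "(?f \<longlongrightarrow> ?f a) (at a within {0<..<1})"
    by (rule LIM_zero_cancel)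
qed

text \<open>The set of minimizers meets a nonempty closed \<open>S\<close> exactly when the infimum
  over \<open>S\<close> does not exceed the infimum over \<open>U i\<close>, since both are
  attained. This compares two continuous functions of \<open>\<theta>\<close>, so the measurability
  required for selection holds.\<close>

lemma minimizing_selector_exists: "\<exists>us. minimizing_selector U d lam c w us"
proof -
  let ?N = "restrict_space borel {0<..<1} :: real measure"
  let ?K = "\<lambda>i \<theta>. {v \<in> U i. hjb \<theta> i v = (INF v\<in>U i. hjb \<theta> i v)}"
  have "\<exists>s \<in> ?N \<rightarrow>\<^sub>M borel_of (topo i). \<forall>\<theta>\<in>space ?N. s \<theta> \<in> ?K i \<theta>" for i
  proof (rule Metric_space.measurable_selection[OF U_metric U_compact])
    fix \<theta> assume "\<theta> \<in> space ?N"
    then have \<theta>: "\<theta> \<in> {0<..<1}" by (simp add: space_restrict_space)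
    show "closedin (topo i) (?K i \<theta>)"
      using closedin_continuous_map_preimage[OF continuous_map_hjb[OF \<theta>],
          of "{INF v\<in>U i. hjb \<theta> i v}" i] by simp
    show "?K i \<theta> \<noteq> {}"
      using hjb_attains_INF[OF \<theta>, of i "U i"] U_nonempty[of i] closedin_topspace[of "topo i"] by auto
  next
    fix S assume S: "closedin (topo i) S"
    then have SU: "S \<subseteq> U i" using closedin_subset by fastforce
    show "{\<theta> \<in> space ?N. ?K i \<theta> \<inter> S \<noteq> {}} \<in> sets ?N"
    proof (cases "S = {}")
      case False
      have "?K i \<theta> \<inter> S \<noteq> {} \<longleftrightarrow> (INF v\<in>S. hjb \<theta> i v) \<le> (INF v\<in>U i. hjb \<theta> i v)"
        if "\<theta> \<in> space ?N" for \<theta>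
      proof -
        have \<theta>: "\<theta> \<in> {0<..<1}" using that by (simp add: space_restrict_space)
        show ?thesis
        proof
          assume "?K i \<theta> \<inter> S \<noteq> {}"
          then obtain v where "v \<in> S" "hjb \<theta> i v = (INF v\<in>U i. hjb \<theta> i v)" by auto
          then show "(INF v\<in>S. hjb \<theta> i v) \<le> (INF v\<in>U i. hjb \<theta> i v)"
            using hjb_INF_lower[OF \<theta> SU] by metis
        next
          assume le: "(INF v\<in>S. hjb \<theta> i v) \<le> (INF v\<in>U i. hjb \<theta> i v)"
          obtain v where v: "v \<in> S" "hjb \<theta> i v = (INF v\<in>S. hjb \<theta> i v)"
            using hjb_attains_INF[OF \<theta> S False] by blast
          then have "hjb \<theta> i v = (INF v\<in>U i. hjb \<theta> i v)"
            using le hjb_INF_lower[OF \<theta> order_refl, of v i] SU by auto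
          then show "?K i \<theta> \<inter> S \<noteq> {}" using v SU by auto
        qed
      qed
      then have "{\<theta> \<in> space ?N. ?K i \<theta> \<inter> S \<noteq> {}} =
          {\<theta> \<in> space ?N. (INF v\<in>S. hjb \<theta> i v) \<le> (INF v\<in>U i. hjb \<theta> i v)}"
        by blast
      also have "\<dots> \<in> sets ?N"
        using U_nonempty
        by (intro borel_measurable_le borel_measurable_continuous_on_restrict
            continuous_on_hjb_INF SU False order_refl)
      finally show ?thesis .
    qed simp
  qed
  then obtain s where s: "\<And>i. s i \<in> ?N \<rightarrow>\<^sub>M borel_of (topo i)"
      "\<And>i \<theta>. \<theta> \<in> space ?N \<Longrightarrow> s i \<theta> \<in> ?K i \<theta>"
    by metis
  have "minimizing_selector U d lam c w (\<lambda>\<theta> i. s i \<theta>)"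
    unfolding minimizing_selector_def action_borel_def
    using s by (auto simp: space_restrict_space)
  then show ?thesis by blast
qed

section \<open>The value in discounted time\<close>

lemma discounted_in_unit:
  assumes "\<theta> \<in> {0<..<1}" "0 \<le> t"
  shows "\<theta> * exp (- \<alpha> * t) \<in> {0<..<1}"
proof -
  have \<theta>: "0 < \<theta>" "\<theta> < 1" using assms(1) by auto
  have "\<theta> * exp (- \<alpha> * t) \<le> \<theta> * 1"
    using \<theta> assms(2) discount by (intro mult_left_mono) auto
  moreover have "0 < \<theta> * exp (- \<alpha> * t)" using \<theta> by simp
  ultimately show ?thesis using \<theta> unfolding greaterThanLessThan_iff by linarith
qed

lemma selector_markov_control:
  assumes "minimizing_selector U d lam c w us" and \<theta>: "\<theta> \<in> {0<..<1}"
  shows "(\<lambda>t i. us (\<theta> * exp (- \<alpha> * t)) i) \<in> markov_controls U d"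
  unfolding markov_controls_def
proof (intro CollectI allI)
  fix i
  have "(\<lambda>t. \<theta> * exp (- \<alpha> * t)) \<in> restrict_space borel {0..} \<rightarrow>\<^sub>M restrict_space borel {0<..<1}"
  proof (rule measurable_restrict_space2)
    show "(\<lambda>t. \<theta> * exp (- \<alpha> * t)) \<in> borel_measurable (restrict_space borel {0..})"
      by (intro borel_measurable_continuous_on_restrict continuous_intros)
  qed (use discounted_in_unit[OF \<theta>] in \<open>auto simp: space_restrict_space\<close>)
  moreover have "(\<lambda>\<theta>. us \<theta> i) \<in> restrict_space borel {0<..<1} \<rightarrow>\<^sub>M action_borel U d i"
    using assms(1) by (simp add: minimizing_selector_def)
  ultimately show "(\<lambda>t. us (\<theta> * exp (- \<alpha> * t)) i) \<in> restrict_space borel {0..} \<rightarrow>\<^sub>M action_borel U d i"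
    by (rule measurable_compose)
qed

text \<open>Along \<open>\<theta> * exp (- \<alpha> * t)\<close> the operator
  \<open>\<alpha> * \<theta> * d/d\<theta>\<close> becomes \<open>- d/dt\<close>, so the equation
  for \<open>w\<close> turns into a backward equation in time with value \<open>1\<close> at
  infinity.\<close>

definition V :: "real \<Rightarrow> real \<Rightarrow> nat \<Rightarrow> real" where
  "V \<theta> t i = w (\<theta> * exp (- \<alpha> * t)) i"

lemma V_bound: "\<theta> \<in> {0<..<1} \<Longrightarrow> 0 \<le> t \<Longrightarrow> \<bar>V \<theta> t i\<bar> \<le> B"
  unfolding V_def by (intro w_bounded discounted_in_unit)

lemma V_lipschitz:
  assumes \<theta>: "\<theta> \<in> {0<..<1}" and st: "0 \<le> s" "s \<le> t"
  shows "\<bar>V \<theta> t i - V \<theta> s i\<bar> \<le> D * (t - s)"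
proof -
  have ln: "ln (\<theta> * exp (- \<alpha> * r)) = ln \<theta> - \<alpha> * r" for r
    using \<theta> by (simp add: ln_mult)
  have "\<bar>V \<theta> t i - V \<theta> s i\<bar> \<le> D / \<alpha> * \<bar>ln (\<theta> * exp (- \<alpha> * t)) - ln (\<theta> * exp (- \<alpha> * s))\<bar>"
    unfolding V_def using st by (intro w_log_lipschitz discounted_in_unit[OF \<theta>]) auto
  also have "\<bar>ln (\<theta> * exp (- \<alpha> * t)) - ln (\<theta> * exp (- \<alpha> * s))\<bar> = \<alpha> * (t - s)"
    unfolding ln using discount st by (simp add: abs_if algebra_simps)
  finally show ?thesis using discount by simp
qed

text \<open>By the chain rule and the equation, the negative time derivative of \<open>V\<close> is
  the infimum \<open>H\<close>. Its continuity justifies the fundamental theorem of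
  calculus.\<close>

lemma V_integral:
  fixes i :: nat
  assumes \<theta>: "\<theta> \<in> {0<..<1}" and st: "0 \<le> s" "s \<le> t"
  defines "H \<equiv> \<lambda>r. INF v\<in>U i. hjb (\<theta> * exp (- \<alpha> * r)) i v"
  shows "set_integrable lborel {s..t} H" "V \<theta> s i - V \<theta> t i = (LINT r:{s..t}|lborel. H r)"
proof -
  have unit: "\<theta> * exp (- \<alpha> * r) \<in> {0<..<1}" if "r \<in> {s..t}" for r
    using that st by (intro discounted_in_unit \<theta>) auto
  have cont: "continuous_on {s..t} H"
    unfolding H_def
    by (rule continuous_on_compose2[OF continuous_on_hjb_INF[OF order_refl U_nonempty]])
      (use unit in \<open>auto intro!: continuous_intros\<close>)
  show "set_integrable lborel {s..t} H"
    unfolding set_integrable_def by (rule borel_integrable_compact[OF _ cont]) simp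
  have "((\<lambda>r. - V \<theta> r i) has_vector_derivative H r) (at r within {s..t})" if "s \<le> r" "r \<le> t" for r
  proof -
    have u: "\<theta> * exp (- \<alpha> * r) \<in> {0<..<1}" using that by (intro unit) simp
    have "((\<lambda>r. - w (\<theta> * exp (- \<alpha> * r)) i) has_real_derivative
        - (deriv (\<lambda>s. w s i) (\<theta> * exp (- \<alpha> * r)) * (\<theta> * (exp (- \<alpha> * r) * - \<alpha>)))) (at r within {s..t})"
      by (intro DERIV_minus DERIV_chain2[where f = "\<lambda>s. w s i" and g = "\<lambda>r. \<theta> * exp (- \<alpha> * r)" and x = r,
            OF w_DERIV[OF u]]) (auto intro!: derivative_eq_intros)
    moreover have "- (deriv (\<lambda>s. w s i) (\<theta> * exp (- \<alpha> * r)) * (\<theta> * (exp (- \<alpha> * r) * - \<alpha>))) = H r"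
      unfolding H_def w_hjb[OF u, symmetric] by (simp add: algebra_simps)
    ultimately show ?thesis
      unfolding V_def by (simp add: has_real_derivative_iff_has_vector_derivative)
  qed
  from integral_FTC_Icc[OF st(2) this cont]
  show "V \<theta> s i - V \<theta> t i = (LINT r:{s..t}|lborel. H r)"
    by (simp add: set_lebesgue_integral_def)
qed

end

section \<open>The exponential cost over the infinite horizon\<close>

locale controlled_hjb = hjb_problem U d lam M c w \<alpha> C B + controlled_law U d lam M u x0 Q
  for U :: "nat \<Rightarrow> 'u set" and d lam M c w \<alpha> C B u x0 Q +
  fixes \<theta> :: real
  assumes \<theta>: "\<theta> \<in> {0<..<1}"
begin

definition q :: "nat \<Rightarrow> real \<Rightarrow> real" where
  "q k r = \<theta> * exp (- \<alpha> * r) * c k (u r k)"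

lemma q_measurable: "q k \<in> borel_measurable (restrict_space borel {0..})"
proof -
  have "(\<lambda>r. \<theta> * exp (- \<alpha> * r)) \<in> borel_measurable (restrict_space borel {0..})"
    by (intro borel_measurable_continuous_on_restrict continuous_intros)
  moreover have "(\<lambda>r. c k (u r k)) \<in> borel_measurable (restrict_space borel {0..})"
    by (rule borel_measurable_control[OF control cost_cont])
  ultimately show ?thesis
    unfolding q_def by (rule borel_measurable_times)
qed

lemma q_bounds:
  assumes "0 \<le> r"
  shows "0 \<le> q k r" "q k r \<le> C * exp (- \<alpha> * r)" "q k r \<le> C"
proof -
  have v: "u r k \<in> U k" by (rule control_in_U[OF control assms])
  note c = cost_nonneg[OF v] cost_le[OF v]
  show "0 \<le> q k r" using \<theta> c by (simp add: q_def)
  have "\<theta> * c k (u r k) \<le> 1 * C" using \<theta> c by (intro mult_mono) auto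
  then have "(\<theta> * c k (u r k)) * exp (- \<alpha> * r) \<le> (1 * C) * exp (- \<alpha> * r)"
    by (rule mult_right_mono) simp
  then show le: "q k r \<le> C * exp (- \<alpha> * r)" by (simp add: q_def algebra_simps)
  have "C * exp (- \<alpha> * r) \<le> C * 1"
    using C_nonneg discount assms by (intro mult_left_mono) auto
  with le show "q k r \<le> C" by simp
qed

text \<open>The number \<open>\<theta> * exp (- \<alpha> * r)\<close> has two roles: it is the
  discounted weight of the running cost at time \<open>r\<close> and the parameter at which the
  equation for \<open>w\<close> is read. This is why a minimizing control evaluates the selector
  there.\<close>

lemma hjb_along_control:
  "hjb (\<theta> * exp (- \<alpha> * r)) k (u r k) = q k r * V \<theta> r k + generator lam u r (V \<theta> r) k"
  by (simp add: hjb_expr_def q_def V_def generator_def)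

lemmas value_facts = q_measurable q_bounds(1) q_bounds(3) V_bound[OF \<theta>] V_lipschitz[OF \<theta>]

text \<open>Measurability along paths is available on bounded time intervals only, hence the passage
  to the limit over \<open>{0..real n}\<close>; discounting supplies the integrable
  majorant.\<close>

lemma set_integrable_q_halfline:
  assumes "\<omega> \<in> cadlag"
  shows "set_integrable lborel {0..} (\<lambda>r. q (\<omega> r) r)"
proof -
  have meas: "(\<lambda>r. indicator {0..} r *\<^sub>R q (\<omega> r) r) \<in> borel_measurable lborel"
  proof (rule borel_measurable_LIMSEQ_real)
    fix n :: nat
    have "set_integrable lborel {0..real n} (\<lambda>r. q (\<omega> r) r)"
      using q_bounds by (intro set_integrable_path[OF assms order_refl q_measurable, where b = C]) auto
    then show "(\<lambda>r. indicator {0..real n} r *\<^sub>R q (\<omega> r) r) \<in> borel_measurable lborel"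
      unfolding set_integrable_def by simp
  next
    fix r :: real
    have "eventually (\<lambda>n. r \<le> real n) sequentially"
      using filterlim_real_sequentially by (simp add: filterlim_at_top)
    then show "(\<lambda>n. indicator {0..real n} r *\<^sub>R q (\<omega> r) r) \<longlonglongrightarrow> indicator {0..} r *\<^sub>R q (\<omega> r) r"
      by (intro tendsto_eventually) (auto elim!: eventually_mono simp: indicator_def)
  qed
  have "set_integrable lborel {0..} (\<lambda>r. C * exp (- \<alpha> * r))"
    by (intro set_integrable_mult_right impI set_integrable_exp_decay discount)
  then show ?thesis
  proof (rule set_integrable_bound)
    show "set_borel_measurable lborel {0..} (\<lambda>r. q (\<omega> r) r)"
      using meas by (simp add: set_borel_measurable_def)
    show "AE r in lborel. r \<in> {0..} \<longrightarrow> norm (q (\<omega> r) r) \<le> norm (C * exp (- \<alpha> * r))"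
      using q_bounds C_nonneg by (auto simp: abs_mult)
  qed
qed

text \<open>The cost is evaluated at left limits, the martingale problem at the path itself; the two
  differ only at the countably many jump times, a null set.\<close>

lemma discounted_cost_eq:
  assumes "\<omega> \<in> cadlag"
  shows "\<theta> * discounted_cost c \<alpha> u \<omega> = (LINT r:{0..}|lborel. q (\<omega> r) r)"
proof -
  have "discounted_cost c \<alpha> u \<omega> = (LINT t:{0..}|lborel. exp (- \<alpha> * t) * c (\<omega> t) (u t (\<omega> t)))"
    unfolding discounted_cost_def set_lebesgue_integral_def
    by (rule integral_discrete_difference[OF cadlag_countable_jumps[OF assms]]) auto
  then show ?thesis
    by (simp add: q_def mult.assoc)
qed

lemma acc_le_total:
  assumes "\<omega> \<in> cadlag" "0 \<le> t"
  shows "(LINT r:{0..t}|lborel. q (\<omega> r) r) \<le> (LINT r:{0..}|lborel. C * exp (- \<alpha> * r))"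
proof -
  have "(LINT r:{0..t}|lborel. q (\<omega> r) r) \<le> (LINT r:{0..}|lborel. q (\<omega> r) r)"
    unfolding set_lebesgue_integral_def
  proof (rule integral_mono)
    show "integrable lborel (\<lambda>r. indicator {0..t} r *\<^sub>R q (\<omega> r) r)"
      using set_integrable_subset[OF set_integrable_q_halfline[OF assms(1)], of "{0..t}"]
      by (auto simp: set_integrable_def)
    show "integrable lborel (\<lambda>r. indicator {0..} r *\<^sub>R q (\<omega> r) r)"
      using set_integrable_q_halfline[OF assms(1)] by (simp add: set_integrable_def)
  qed (use q_bounds(1) in \<open>auto simp: indicator_def\<close>)
  also have "\<dots> \<le> (LINT r:{0..}|lborel. C * exp (- \<alpha> * r))"
    using q_bounds(2) by (intro set_integral_mono set_integrable_q_halfline assms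
        set_integrable_mult_right impI set_integrable_exp_decay discount) auto
  finally show ?thesis .
qed

text \<open>Nothing is known about where the path is at large times; the limit exists because
  \<open>w\<close> tends to \<open>1\<close> uniformly in the state.\<close>

lemma value_along_path_tendsto:
  "(\<lambda>n. V \<theta> (real n) (\<omega> (real n))) \<longlonglongrightarrow> 1"
proof (rule tendstoI)
  fix e :: real assume "0 < e"
  then have "\<forall>\<^sub>F x in at_right 0. \<forall>i\<in>UNIV. dist (w x i) 1 < e"
    using uniform_limitD[OF w_limit] by simp
  moreover have "filterlim (\<lambda>n. \<theta> * exp (- \<alpha> * real n)) (at_right 0) sequentially"
    unfolding filterlim_at
  proof
    have "(\<lambda>n. \<theta> * exp (- \<alpha>) ^ n) \<longlonglongrightarrow> \<theta> * 0"
      using discount by (intro tendsto_mult tendsto_const LIMSEQ_realpow_zero) auto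
    then show "(\<lambda>n. \<theta> * exp (- \<alpha> * real n)) \<longlonglongrightarrow> 0"
      unfolding exp_of_nat2_mult mult_zero_right .
  qed (use \<theta> in auto)
  ultimately have "\<forall>\<^sub>F n in sequentially. \<forall>i\<in>UNIV. dist (w (\<theta> * exp (- \<alpha> * real n)) i) 1 < e"
    by (rule eventually_compose_filterlim)
  then show "\<forall>\<^sub>F n in sequentially. dist (V \<theta> (real n) (\<omega> (real n))) 1 < e"
    by eventually_elim (simp add: V_def)
qed

text \<open>Dominated convergence with a constant bound: the running cost is at most
  \<open>C * exp (- \<alpha> * r)\<close>, which has a finite integral, and \<open>V\<close> is at
  most \<open>B\<close> in modulus.\<close>

lemma expected_value_tendsto:
  shows "integrable Q (\<lambda>\<omega>. exp (\<theta> * discounted_cost c \<alpha> u \<omega>))"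
    and "(\<lambda>n. \<integral>\<omega>. exp (LINT r:{0..real n}|lborel. q (\<omega> r) r) * V \<theta> (real n) (\<omega> (real n)) \<partial>Q)
      \<longlonglongrightarrow> (\<integral>\<omega>. exp (\<theta> * discounted_cost c \<alpha> u \<omega>) \<partial>Q)"
proof -
  let ?s = "\<lambda>n \<omega>. exp (LINT r:{0..real n}|lborel. q (\<omega> r) r) * V \<theta> (real n) (\<omega> (real n))"
  let ?f = "\<lambda>\<omega>. exp (\<theta> * discounted_cost c \<alpha> u \<omega>)"
  let ?b = "\<lambda>\<omega> :: real \<Rightarrow> nat. exp (LINT r:{0..}|lborel. C * exp (- \<alpha> * r)) * B"
  have int: "integrable Q (?s n)" for n
    using integrable_exp_acc[OF value_facts, of "real n"] by (simp add: acc_def[OF value_facts])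
  have lim: "(\<lambda>n. ?s n \<omega>) \<longlonglongrightarrow> ?f \<omega>" if "\<omega> \<in> space Q" for \<omega>
  proof -
    note cad = path_cadlag[OF that]
    have "((\<lambda>t. LINT r:{0..t}|lborel. q (\<omega> r) r) \<longlongrightarrow> (LINT r:{0..}|lborel. q (\<omega> r) r)) at_top"
      by (rule tendsto_set_lebesgue_integral_at_top) (use set_integrable_q_halfline[OF cad] in auto)
    then have "(\<lambda>n. LINT r:{0..real n}|lborel. q (\<omega> r) r) \<longlonglongrightarrow> (LINT r:{0..}|lborel. q (\<omega> r) r)"
      by (rule filterlim_compose[OF _ filterlim_real_sequentially])
    from tendsto_mult[OF tendsto_exp[OF this] value_along_path_tendsto, of \<omega>]
    show ?thesis by (simp add: discounted_cost_eq[OF cad])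
  qed
  have meas: "?f \<in> borel_measurable Q"
    by (rule borel_measurable_LIMSEQ_real[OF lim]) (use int in auto)
  have bound: "norm (?s n \<omega>) \<le> ?b \<omega>" if "\<omega> \<in> space Q" for n \<omega>
    using V_bound[OF \<theta>, of "real n" "\<omega> (real n)"] acc_le_total[OF path_cadlag[OF that], of "real n"]
    by (auto simp: abs_mult intro!: mult_mono)
  show "integrable Q ?f"
    by (rule integrable_dominated_convergence[where w = ?b and s = ?s]) (use int meas lim bound in auto)
  show "(\<lambda>n. \<integral>\<omega>. ?s n \<omega> \<partial>Q) \<longlonglongrightarrow> (\<integral>\<omega>. ?f \<omega> \<partial>Q)"
    by (rule integral_dominated_convergence[where w = ?b]) (use int meas lim bound in auto)
qed

text \<open>Costs are nonnegative. The bound keeps the argument of \<open>ln\<close> in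
  \<open>risk_cost\<close> positive, so that \<open>exp\<close> undoes the logarithm.\<close>

lemma expected_cost_ge_1: "1 \<le> (\<integral>\<omega>. exp (\<theta> * discounted_cost c \<alpha> u \<omega>) \<partial>Q)"
proof -
  have "(\<integral>\<omega>. 1 \<partial>Q) \<le> (\<integral>\<omega>. exp (\<theta> * discounted_cost c \<alpha> u \<omega>) \<partial>Q)"
  proof (rule integral_mono)
    fix \<omega> assume "\<omega> \<in> space Q"
    note cad = path_cadlag[OF this]
    have "0 \<le> (LINT r:{0..}|lborel. q (\<omega> r) r)"
      unfolding set_lebesgue_integral_def
      by (intro Bochner_Integration.integral_nonneg) (simp add: indicator_def q_bounds(1))
    then show "1 \<le> exp (\<theta> * discounted_cost c \<alpha> u \<omega>)"
      by (simp add: discounted_cost_eq[OF cad])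
  qed (use expected_value_tendsto(1) in auto)
  then show ?thesis by (simp add: prob_space)
qed

lemma exp_risk_cost:
  assumes "P u x0 = Q"
  shows "exp (\<theta> * risk_cost P c \<alpha> \<theta> x0 u) = (\<integral>\<omega>. exp (\<theta> * discounted_cost c \<alpha> u \<omega>) \<partial>Q)"
  using expected_cost_ge_1 \<theta> by (simp add: risk_cost_def assms)

lemma value_le_expected_cost: "w \<theta> x0 \<le> (\<integral>\<omega>. exp (\<theta> * discounted_cost c \<alpha> u \<omega>) \<partial>Q)"
proof -
  have super: "V \<theta> s k - V \<theta> t k \<le> (LINT r:{s..t}|lborel. q k r * V \<theta> r k + generator lam u r (V \<theta> r) k)"
    if st: "0 \<le> s" "s \<le> t" for k s t
  proof -
    have "(LINT r:{s..t}|lborel. INF v\<in>U k. hjb (\<theta> * exp (- \<alpha> * r)) k v)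
        \<le> (LINT r:{s..t}|lborel. q k r * V \<theta> r k + generator lam u r (V \<theta> r) k)"
    proof (rule set_integral_mono[OF V_integral(1)[OF \<theta> st] frozen_set_integrable[OF value_facts st(1)]])
      fix r assume "r \<in> {s..t}"
      then have r: "0 \<le> r" using st by simp
      show "(INF v\<in>U k. hjb (\<theta> * exp (- \<alpha> * r)) k v) \<le> q k r * V \<theta> r k + generator lam u r (V \<theta> r) k"
        unfolding hjb_along_control[symmetric]
        by (intro hjb_INF_lower discounted_in_unit \<theta> r order_refl control_in_U[OF control])
    qed
    then show ?thesis using V_integral(2)[OF \<theta> st] by simp
  qed
  have "V \<theta> 0 x0 \<le> (\<integral>\<omega>. exp (LINT r:{0..real n}|lborel. q (\<omega> r) r) * V \<theta> (real n) (\<omega> (real n)) \<partial>Q)" for n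
    by (rule expected_value_mono[OF value_facts super]) auto
  then show ?thesis
    using LIMSEQ_le_const[OF expected_value_tendsto(2)] by (auto simp: V_def)
qed

lemma value_eq_expected_cost:
  assumes min: "\<And>r k. 0 \<le> r \<Longrightarrow>
    (INF v\<in>U k. hjb (\<theta> * exp (- \<alpha> * r)) k v) = hjb (\<theta> * exp (- \<alpha> * r)) k (u r k)"
  shows "w \<theta> x0 = (\<integral>\<omega>. exp (\<theta> * discounted_cost c \<alpha> u \<omega>) \<partial>Q)"
proof (rule antisym[OF value_le_expected_cost])
  let ?V = "\<lambda>r k. - V \<theta> r k"
  \<comment> \<open>For a minimizing control the integrated condition holds with equality, and both
    of its sides are linear in \<open>V\<close>, so it survives the change of sign.\<close>
  have super: "?V s k - ?V t k \<le> (LINT r:{s..t}|lborel. q k r * ?V r k + generator lam u r (?V r) k)"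
    if st: "0 \<le> s" "s \<le> t" for k s t
  proof -
    have "q k r * ?V r k + generator lam u r (?V r) k = - (INF v\<in>U k. hjb (\<theta> * exp (- \<alpha> * r)) k v)"
      if r: "0 \<le> r" for r
    proof -
      have "generator lam u r (?V r) k = - generator lam u r (V \<theta> r) k"
        using suminf_minus[OF rate_sum_bounded(1)[of "u r k" k "V \<theta> r" B,
              OF control_in_U[OF control r] V_bound[OF \<theta> r]]]
        by (simp add: generator_def)
      then show ?thesis unfolding min[OF r] hjb_along_control by simp
    qed
    then have "(LINT r:{s..t}|lborel. q k r * ?V r k + generator lam u r (?V r) k) =
        (LINT r:{s..t}|lborel. - (INF v\<in>U k. hjb (\<theta> * exp (- \<alpha> * r)) k v))"
      using st by (intro set_lebesgue_integral_cong) auto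
    also have "\<dots> = ?V s k - ?V t k"
      using set_integral_uminus[OF V_integral(1)[OF \<theta> st]] V_integral(2)[OF \<theta> st, of k] by simp
    finally show ?thesis by simp
  qed
  have "?V 0 x0 \<le> (\<integral>\<omega>. exp (LINT r:{0..real n}|lborel. q (\<omega> r) r) * ?V (real n) (\<omega> (real n)) \<partial>Q)" for n
    by (rule expected_value_mono[OF q_measurable q_bounds(1) q_bounds(3), where B = B and L = D])
      (use V_bound[OF \<theta>] V_lipschitz[OF \<theta>] super in \<open>auto simp: abs_minus_commute\<close>)
  then have "(\<integral>\<omega>. exp (LINT r:{0..real n}|lborel. q (\<omega> r) r) * V \<theta> (real n) (\<omega> (real n)) \<partial>Q) \<le> w \<theta> x0" for n
    by (simp add: V_def)
  then show "(\<integral>\<omega>. exp (\<theta> * discounted_cost c \<alpha> u \<omega>) \<partial>Q) \<le> w \<theta> x0"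
    using LIMSEQ_le_const2[OF expected_value_tendsto(2)] by blast
qed

end

section \<open>Identification of the value and optimality of selector controls\<close>

theorem theorem3p1:
  fixes U :: "nat \<Rightarrow> 'u set"
    and d :: "nat \<Rightarrow> 'u \<Rightarrow> 'u \<Rightarrow> real"
    and lam :: "nat \<Rightarrow> nat \<Rightarrow> 'u \<Rightarrow> real"
    and c :: "nat \<Rightarrow> 'u \<Rightarrow> real"
    and P :: "(real \<Rightarrow> nat \<Rightarrow> 'u) \<Rightarrow> nat \<Rightarrow> (real \<Rightarrow> nat) measure"
    and w :: "real \<Rightarrow> nat \<Rightarrow> real"
    and M \<alpha> :: real
  assumes actions: "\<And>i. U i \<noteq> {}" "\<And>i. Metric_space (U i) (d i)"
      "\<And>i. compact_space (Metric_space.mtopology (U i) (d i))"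
    and rates_nonneg: "\<And>i j v. j \<noteq> i \<Longrightarrow> v \<in> U i \<Longrightarrow> 0 \<le> lam i j v"
    and rates_diag: "\<And>i v. v \<in> U i \<Longrightarrow> lam i i v = - (\<Sum>j. if j = i then 0 else lam i j v)"
    and A1: "\<And>i j. j \<noteq> i \<Longrightarrow>
      continuous_map (Metric_space.mtopology (U i) (d i)) euclideanreal (lam i j)"
    and A2: "\<And>i v. v \<in> U i \<Longrightarrow> - lam i i v \<le> M"
    and A3: "\<And>i. uniformly_convergent_on (U i)
      (\<lambda>n v. \<Sum>j<n. if j = i then 0 else lam i j v)"
    and law: "\<And>u i. u \<in> markov_controls U d \<Longrightarrow> solves_martingale_problem lam u i (P u i)"
    and cost_nonneg: "\<And>i v. v \<in> U i \<Longrightarrow> 0 \<le> c i v"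
    and cost_bounded: "\<exists>C. \<forall>i. \<forall>v\<in>U i. c i v \<le> C"
    and cost_cont: "\<And>i. continuous_map (Metric_space.mtopology (U i) (d i)) euclideanreal (c i)"
    and discount: "0 < \<alpha>"
    and w_bounded: "\<exists>B. \<forall>\<theta>\<in>{0<..<1}. \<forall>i. \<bar>w \<theta> i\<bar> \<le> B"
    and w_C1: "\<And>i. (\<lambda>\<theta>. w \<theta> i) C1_differentiable_on {0<..<1}"
    and w_hjb: "\<And>\<theta> i. \<theta> \<in> {0<..<1} \<Longrightarrow>
      \<alpha> * \<theta> * deriv (\<lambda>s. w s i) \<theta> = (INF v\<in>U i. hjb_expr lam c w \<theta> i v)"
    and w_limit: "uniform_limit UNIV w (\<lambda>i. 1) (at_right 0)"
  shows "(\<forall>\<theta>\<in>{0<..<1}. \<forall>i. w \<theta> i = value_fun U d P c \<alpha> \<theta> i) \<and>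
    (\<exists>us. minimizing_selector U d lam c w us) \<and>
    (\<forall>us. minimizing_selector U d lam c w us \<longrightarrow>
       (\<forall>\<theta>\<in>{0<..<1}. optimal_control U d P c \<alpha> \<theta> (\<lambda>t i. us (\<theta> * exp (- \<alpha> * t)) i)))"
proof -
  obtain C where C: "\<And>i v. v \<in> U i \<Longrightarrow> c i v \<le> C"
    using cost_bounded by blast
  obtain B where B: "\<And>\<theta> i. \<theta> \<in> {0<..<1} \<Longrightarrow> \<bar>w \<theta> i\<bar> \<le> B"
    using w_bounded by blast
  interpret hjb_problem U d lam M c w \<alpha> C B
    by (intro hjb_problem.intro jump_rates.intro hjb_problem_axioms.intro)
      (fact actions rates_nonneg rates_diag A1 A2 A3 cost_nonneg C cost_cont discount B
        w_C1 w_hjb w_limit)+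
  have controlled: "controlled_hjb U d lam M c w \<alpha> C B u i (P u i) \<theta>"
    if "u \<in> markov_controls U d" "\<theta> \<in> {0<..<1}" for u i \<theta>
    by unfold_locales (fact that law[OF that(1)])+
  let ?cost = "\<lambda>\<theta> i u. exp (\<theta> * risk_cost P c \<alpha> \<theta> i u)"
  have ge: "w \<theta> i \<le> ?cost \<theta> i u" if "u \<in> markov_controls U d" "\<theta> \<in> {0<..<1}" for u i \<theta>
    using controlled_hjb.value_le_expected_cost[OF controlled[OF that, of i]]
      controlled_hjb.exp_risk_cost[OF controlled[OF that, of i], where P = P] by simp
  let ?u = "\<lambda>us \<theta> t i. us (\<theta> * exp (- \<alpha> * t)) i"
  have eq: "w \<theta> i = ?cost \<theta> i (?u us \<theta>)"
    if us: "minimizing_selector U d lam c w us" and \<theta>: "\<theta> \<in> {0<..<1}" for us i \<theta>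
  proof -
    interpret C: controlled_hjb U d lam M c w \<alpha> C B "?u us \<theta>" i "P (?u us \<theta>) i" \<theta>
      by (rule controlled[OF selector_markov_control[OF us \<theta>] \<theta>])
    have "w \<theta> i = (\<integral>\<omega>. exp (\<theta> * discounted_cost c \<alpha> (?u us \<theta>) \<omega>) \<partial>P (?u us \<theta>) i)"
    proof (rule C.value_eq_expected_cost)
      fix r :: real and k assume "0 \<le> r"
      from discounted_in_unit[OF \<theta> this] us
      show "(INF v\<in>U k. hjb (\<theta> * exp (- \<alpha> * r)) k v)
          = hjb (\<theta> * exp (- \<alpha> * r)) k (us (\<theta> * exp (- \<alpha> * r)) k)"
        by (simp add: minimizing_selector_def)
    qed
    then show ?thesis unfolding C.exp_risk_cost[where P = P, OF refl] .
  qed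
  \<comment> \<open>The lower bound \<open>ge\<close> gives only that \<open>w\<close> is at most
    the value; a control that attains it is needed to know that the infimum equals
    \<open>w\<close>.\<close>
  obtain us0 where us0: "minimizing_selector U d lam c w us0"
    using minimizing_selector_exists by blast
  have val: "w \<theta> i = value_fun U d P c \<alpha> \<theta> i" if \<theta>: "\<theta> \<in> {0<..<1}" for \<theta> i
    unfolding value_fun_def
    by (rule cInf_eq_minimum[symmetric])
      (use ge[OF _ \<theta>] eq[OF us0 \<theta>] selector_markov_control[OF us0 \<theta>] in auto)
  have "optimal_control U d P c \<alpha> \<theta> (?u us \<theta>)"
    if us: "minimizing_selector U d lam c w us" and \<theta>: "\<theta> \<in> {0<..<1}" for us \<theta>
    unfolding optimal_control_def
    by (intro conjI allI selector_markov_control[OF us \<theta>] trans[OF eq[OF us \<theta>, symmetric] val[OF \<theta>]])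
  then show ?thesis
    using val us0 by blast
qed

end
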